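(* Let $X$ be a Euclidean space, let $A$ and $B$ be closed subsets of $X$ with $A\cap B\neq\varnothing$, $L:=\operatorname{aff}(A\cup B)$, and $w\in A\cap B$. Let $\lambda,\mu\in(0,2]$, $\widehat\beta:=\big(\frac{\lambda}{2-\lambda}+\frac{\mu}{2-\mu}\big)^{-1}$ (with $\widehat\beta:=0$ if $\lambda=2$ or $\mu=2$), $\alpha\in(0,1+\widehat\beta)$, and $T:=(1-\alpha)\mathrm{Id}+\alpha P_B^\mu P_A^\lambda$. Then the algorithm $x_{n+1}\in Tx_n$ (i) locally (around $w$) converges with $R$-linear rate to a point $\overline{x}$ in each of the following cases: (a) $A$ and $B$ are superregular at $w$ and $\{A,B\}$ is affine-hull regular at $w$, in which case $\overline{x}\in (A\cap B)+(L-L)^\perp$ with $P_A\overline{x}=P_B\overline{x}\in A\cap B$; and if additionally $\{A,B\}$ is strongly regular at $w$, then $\overline{x}\in A\cap B$. (b) $\min\{\lambda,\mu\}<2$, $A$ and $B$ are superregular at $w$ and $\{A,B\}$ is linearly regular around $w$, in which case $\overline{x}\in A\cap B$. (ii) globally converges with $R$-linear rate to a point $\overline{x}$ in each of the following cases: (a) $A$ and $B$ are convex and $\operatorname{ri}A\cap\operatorname{ri}B\neq\varnothing$, in which case $\overline{x}\in (A\cap B)+(L-L)^\perp$ with $P_A\overline{x}=P_B\overline{x}\in A\cap B$; and if additionally $0\in\operatorname{int}(B-A)$, then $\overline{x}\in A\cap B$. (b) $A$ and $B$ are polyhedral, in which case $\overline{x}\in\operatorname{Fix}T\subseteq (A\cap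 B)+N_{A-B}(0)$ with $P_A\overline{x}\in A\cap B$. (c) $\min\{\lambda,\mu\}<2$, $A$ and $B$ are convex and $\{A,B\}$ is boundedly linearly regular, in which case $\overline{x}\in A\cap B$.
   Context: A Euclidean space is a finite-dimensional real inner product space; $\mathbb{B}(w;\rho)$ is the closed ball with center $w$ and radius $\rho$. For nonempty $S\subseteq X$: $d_S(x)=\inf_{c\in S}\|x-c\|$, $P_Sx=\{c\in S:\|x-c\|=d_S(x)\}$ is the (set-valued) projector, identified with its element when a singleton, and $P_S^\lambda:=(1-\lambda)\mathrm{Id}+\lambda P_S$ (set-valued). $Tx=\{(1-\alpha)x+\alpha s: s\in P_B^\mu r,\ r\in P_A^\lambda x\}$; $\operatorname{Fix}T=\{x:x\in Tx\}$. $\operatorname{ri}$, $\operatorname{int}$, $\operatorname{aff}$ denote relative interior, interior, affine hull. Polyhedral sets are finite intersections of closed halfspaces. $R$-linear convergence of $(x_n)$ to $\overline{x}$ means that there are $\rho\in[0,1)$ and $\sigma\ge0$ with $\|x_n-\overline{x}\|\le\sigma\rho^n$ for all $n$. "Locally converges" means: there is $r>0$ such that every sequence with $x_0\in\mathbb{B}(w;r)$ and $x_{n+1}\in Tx_n$ converges $R$-linearly to some point $\overline{x}$ (depending on the sequence) with the stated property; "globally converges" means this for every $x_0\in X$. Proximal normal cone to $S$ at $x\in S$: $N^{\rm prox}_S(x)=\{\lambda(z-x): z\in X,\ x\in P_Sz,\ \lambda\ge0\}$. Limiting normal cone: $N_S(x)=\{u:\exists x_n\to x,\ u_n\to u,\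 x_n\in S,\ u_n\in N_S^{\rm prox}(x_n)\}$ (for convex $S$ this is the usual normal cone $\{u:\langle u,y-x\rangle\le0\ \forall y\in S\}$). $S$ is superregular at $w$ if for every $\varepsilon>0$ there is $\delta>0$ such that $\langle u,x-y\rangle\ge-\varepsilon\|u\|\|x-y\|$ for all $x,y\in S\cap\mathbb{B}(w;\delta)$ and $u\in N^{\rm prox}_S(x)$. $\{A,B\}$ is affine-hull regular at $w$ if $N_A(w)\cap(-N_B(w))\cap(L-w)=\{0\}$ with $L=\operatorname{aff}(A\cup B)$, and strongly regular at $w$ if $N_A(w)\cap(-N_B(w))=\{0\}$. $\{A,B\}$ is $\kappa$-linearly regular on $U$ if $d_{A\cap B}(x)\le\kappa\max\{d_A(x),d_B(x)\}$ for all $x\in U$; linearly regular around $w$ if this holds on $U=\mathbb{B}(w;\delta)$ for some $\delta,\kappa>0$; boundedly linearly regular if for every bounded $U\subseteq X$ it holds for some $\kappa>0$. *)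

theory Defs
  imports "HOL-Analysis.Analysis"
begin

(* On sets, the library operator "-" is set difference, so the pointwise (Minkowski)
   difference needs its own name; "+" on sets is the Minkowski sum of Set_Algebras. *)
definition mink_diff :: "'a::euclidean_space set \<Rightarrow> 'a set \<Rightarrow> 'a set" where
  "mink_diff S R = {s - r | s r. s \<in> S \<and> r \<in> R}"

definition proj :: "'a::euclidean_space set \<Rightarrow> 'a \<Rightarrow> 'a set" where
  "proj S x = {c \<in> S. norm (x - c) = infdist x S}"

definition relaxed_proj :: "'a::euclidean_space set \<Rightarrow> real \<Rightarrow> 'a \<Rightarrow> 'a set" where
  "relaxed_proj S l x = {(1 - l) *\<^sub>R x + l *\<^sub>R p | p. p \<in> proj S x}"

(* The set-valued operator (1 - \<alpha>) Id + \<alpha> P_B^m P_A^l: first the l-relaxed projector of A,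
   then the m-relaxed projector of B. *)
definition alg_op ::
  "'a::euclidean_space set \<Rightarrow> 'a set \<Rightarrow> real \<Rightarrow> real \<Rightarrow> real \<Rightarrow> 'a \<Rightarrow> 'a set" where
  "alg_op A B l m \<alpha> x =
     {(1 - \<alpha>) *\<^sub>R x + \<alpha> *\<^sub>R s | s r. r \<in> relaxed_proj A l x \<and> s \<in> relaxed_proj B m r}"

definition Fix :: "('a \<Rightarrow> 'a set) \<Rightarrow> 'a set" where
  "Fix T = {x. x \<in> T x}"

(* The case distinction is needed: in HOL, 2 / (2 - 2) = 0. *)
definition beta_hat :: "real \<Rightarrow> real \<Rightarrow> real" where
  "beta_hat l m =
     (if l = 2 \<or> m = 2 then 0 else inverse (l / (2 - l) + m / (2 - m)))"

definition R_linear_conv :: "(nat \<Rightarrow> 'a::euclidean_space) \<Rightarrow> 'a \<Rightarrow> bool" where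
  "R_linear_conv x xbar \<longleftrightarrow>
     (\<exists>\<rho> \<sigma>. 0 \<le> \<rho> \<and> \<rho> < 1 \<and> 0 \<le> \<sigma> \<and> (\<forall>n. norm (x n - xbar) \<le> \<sigma> * \<rho> ^ n))"

(* In the next two definitions Q is the property required of the limit point. The limit and
   the rate may depend on the generated sequence; the radius r may not. *)
definition locally_converges ::
  "('a::euclidean_space \<Rightarrow> 'a set) \<Rightarrow> 'a \<Rightarrow> ('a \<Rightarrow> bool) \<Rightarrow> bool" where
  "locally_converges T w Q \<longleftrightarrow>
     (\<exists>r>0. \<forall>x. x 0 \<in> cball w r \<longrightarrow> (\<forall>n. x (Suc n) \<in> T (x n)) \<longrightarrow>
        (\<exists>xbar. R_linear_conv x xbar \<and> Q xbar))"

definition globally_converges ::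
  "('a::euclidean_space \<Rightarrow> 'a set) \<Rightarrow> ('a \<Rightarrow> bool) \<Rightarrow> bool" where
  "globally_converges T Q \<longleftrightarrow>
     (\<forall>x. (\<forall>n. x (Suc n) \<in> T (x n)) \<longrightarrow> (\<exists>xbar. R_linear_conv x xbar \<and> Q xbar))"

definition prox_normal_cone :: "'a::euclidean_space set \<Rightarrow> 'a \<Rightarrow> 'a set" where
  "prox_normal_cone S x = {t *\<^sub>R (z - x) | t z. x \<in> proj S z \<and> 0 \<le> t}"

definition limiting_normal_cone :: "'a::euclidean_space set \<Rightarrow> 'a \<Rightarrow> 'a set" where
  "limiting_normal_cone S x =
     {u. \<exists>xs us. xs \<longlonglongrightarrow> x \<and> us \<longlonglongrightarrow> u \<and>
           (\<forall>n. xs n \<in> S \<and> us n \<in> prox_normal_cone S (xs n))}"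

definition superregular :: "'a::euclidean_space set \<Rightarrow> 'a \<Rightarrow> bool" where
  "superregular S w \<longleftrightarrow>
     (\<forall>\<epsilon>>0. \<exists>\<delta>>0. \<forall>x \<in> S \<inter> cball w \<delta>. \<forall>y \<in> S \<inter> cball w \<delta>. \<forall>u \<in> prox_normal_cone S x.
        u \<bullet> (x - y) \<ge> - \<epsilon> * norm u * norm (x - y))"

definition affine_hull_regular :: "'a::euclidean_space set \<Rightarrow> 'a set \<Rightarrow> 'a \<Rightarrow> bool" where
  "affine_hull_regular A B w \<longleftrightarrow>
     limiting_normal_cone A w \<inter> uminus ` limiting_normal_cone B w
       \<inter> mink_diff (affine hull (A \<union> B)) {w} = {0}"

definition strongly_regular :: "'a::euclidean_space set \<Rightarrow> 'a set \<Rightarrow> 'a \<Rightarrow> bool" where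
  "strongly_regular A B w \<longleftrightarrow>
     limiting_normal_cone A w \<inter> uminus ` limiting_normal_cone B w = {0}"

definition linearly_regular_on ::
  "real \<Rightarrow> 'a::euclidean_space set \<Rightarrow> 'a set \<Rightarrow> 'a set \<Rightarrow> bool" where
  "linearly_regular_on \<kappa> A B U \<longleftrightarrow>
     (\<forall>x\<in>U. infdist x (A \<inter> B) \<le> \<kappa> * max (infdist x A) (infdist x B))"

definition linearly_regular_around :: "'a::euclidean_space set \<Rightarrow> 'a set \<Rightarrow> 'a \<Rightarrow> bool" where
  "linearly_regular_around A B w \<longleftrightarrow>
     (\<exists>\<delta>>0. \<exists>\<kappa>>0. linearly_regular_on \<kappa> A B (cball w \<delta>))"

definition boundedly_linearly_regular :: "'a::euclidean_space set \<Rightarrow> 'a set \<Rightarrow> bool" where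
  "boundedly_linearly_regular A B \<longleftrightarrow>
     (\<forall>U. bounded U \<longrightarrow> (\<exists>\<kappa>>0. linearly_regular_on \<kappa> A B U))"

end

theory Submission
  imports Defs
begin

text \<open>
  Write \<open>u = x - p\<close> and \<open>v = r - q\<close> for the residuals of the two projection steps. An exact
  identity expresses the change of the squared distance to a common point \<open>c\<close> by the gain
  \<open>l (2 - l) |u|\<^sup>2 + m (2 - m) |v|\<^sup>2 + (1 - \<alpha>) |l u + m v|\<^sup>2\<close>, up to inner products that
  superregularity makes negligible. The bound on \<open>\<alpha>\<close> makes the gain coercive in \<open>(u, v)\<close> when
  \<open>min l m < 2\<close>; for \<open>l = m = 2\<close> it is a multiple of \<open>|u + v|\<^sup>2\<close>, which is coercive when the
  normal cones meet at a positive angle. With linear regularity the distance to \<open>A \<inter> B\<close> then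
  contracts. Affine-hull regularity gives the angle by compactness, and linear regularity
  because alternating projections converge linearly.

  For convex sets the operator is averaged, so the iterates converge to a fixed point and the
  local results apply there. For polyhedra the operator is affine along short segments issuing
  from the limit \<open>w\<close>; Fejer monotonicity forces the directions of \<open>x n - w\<close> away from those of
  fixed points, so by compactness \<open>|x n - T (x n)|\<close> is at least a fixed multiple of \<open>|x n - w|\<close>.
\<close>

section \<open>Projections and the descent identity\<close>

text \<open>The pair \<open>l = m = 2\<close> is the obstacle. Its gain vanishes whenever
  \<open>v = - u\<close>, and this does happen: from \<open>y + z\<close> with \<open>y\<close> in
  \<open>A \<inter> B\<close> and \<open>z\<close> orthogonal to \<open>L - L\<close> the residuals
  are \<open>z\<close> and \<open>- z\<close>, so \<open>y + z\<close> is a fixed point however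
  close it is to \<open>w\<close>. Contraction towards \<open>A \<inter> B\<close> can therefore
  hold only inside \<open>L\<close>. Sequences are translated into \<open>L\<close> by a constant
  \<open>z\<close>, treated there and translated back, which is why the limit is known only up to a
  vector orthogonal to \<open>L - L\<close>.

  Polyhedra come without a condition on relative interiors, so for \<open>l = m = 2\<close> fixed
  points may leave \<open>A \<inter> B\<close> in directions of \<open>L - L\<close> as well. The
  distance to \<open>A \<inter> B\<close> is then useless as a merit function, and the distance to
  the limit itself takes its place.

  The value \<open>beta_hat l m\<close> is what the Cauchy-Schwarz inequality yields when the
  possibly negative last term of the gain is charged against the other two.\<close>

lemma proj_iff:
  assumes "S \<noteq> {}"
  shows "c \<in> proj S x \<longleftrightarrow> c \<in> S \<and> (\<forall>a\<in>S. norm (x - c) \<le> norm (x - a))"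
proof
  assume "c \<in> proj S x"
  then show "c \<in> S \<and> (\<forall>a\<in>S. norm (x - c) \<le> norm (x - a))"
    unfolding proj_def using infdist_le by (fastforce simp: dist_norm)
next
  assume R: "c \<in> S \<and> (\<forall>a\<in>S. norm (x - c) \<le> norm (x - a))"
  have "infdist x S \<le> norm (x - c)"
    using R infdist_le[of c S x] by (simp add: dist_norm)
  moreover have "norm (x - c) \<le> infdist x S"
    unfolding infdist_notempty[OF assms]
    using assms R by (intro cINF_greatest) (auto simp: dist_norm)
  ultimately show "c \<in> proj S x"
    using R by (simp add: proj_def)
qed

lemma projD:
  assumes "c \<in> proj S x"
  shows "c \<in> S" "norm (x - c) = infdist x S" "a \<in> S \<Longrightarrow> norm (x - c) \<le> norm (x - a)"
  using assms infdist_le[of a S x] by (auto simp: proj_def dist_norm)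

lemma proj_nonempty:
  assumes "closed S" "S \<noteq> {}"
  obtains c where "c \<in> proj S x"
proof -
  obtain c where "c \<in> S" "infdist x S = dist x c"
    using infdist_attains_inf[OF assms] by metis
  then show thesis using that by (auto simp: proj_def dist_norm)
qed

lemma proj_self: "x \<in> S \<Longrightarrow> proj S x = {x}"
  by (auto simp: proj_def)

lemma prox_normal_coneI:
  assumes "p \<in> proj S x" shows "x - p \<in> prox_normal_cone S p"
  unfolding prox_normal_cone_def using assms by (auto intro!: exI[of _ 1] exI[of _ x])

lemma prox_normal_cone_scale:
  assumes "u \<in> prox_normal_cone S p" "0 \<le> t" shows "t *\<^sub>R u \<in> prox_normal_cone S p"
proof -
  obtain s z where "u = s *\<^sub>R (z - p)" "p \<in> proj S z" "0 \<le> s"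
    using assms(1) by (auto simp: prox_normal_cone_def)
  then show ?thesis
    unfolding prox_normal_cone_def using assms(2)
    by (auto intro!: exI[of _ "t * s"] exI[of _ z])
qed

text \<open>Expresses a step through the residuals \<open>x - p\<close> and \<open>r - q\<close>,
  the form to which \<open>norm_step_eq\<close> applies with \<open>d = x - c\<close>.\<close>

lemma alg_op_iff:
  "x' \<in> alg_op A B l m \<alpha> x \<longleftrightarrow>
     (\<exists>p q. p \<in> proj A x \<and> q \<in> proj B (x - l *\<^sub>R (x - p)) \<and>
        x' = x - \<alpha> *\<^sub>R (l *\<^sub>R (x - p) + m *\<^sub>R (x - l *\<^sub>R (x - p) - q)))"
proof -
  have r: "(1 - l) *\<^sub>R x + l *\<^sub>R p = x - l *\<^sub>R (x - p)" for p
    by (simp add: algebra_simps)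
  have s: "(1 - \<alpha>) *\<^sub>R x + \<alpha> *\<^sub>R ((1 - m) *\<^sub>R (x - y) + m *\<^sub>R q)
      = x - \<alpha> *\<^sub>R (y + m *\<^sub>R ((x - y) - q))" for y q
    by (simp add: algebra_simps)
  show ?thesis
    unfolding alg_op_def relaxed_proj_def r mem_Collect_eq
    by (metis s)
qed

section \<open>The gain of a step and its coercivity\<close>

definition gain :: "real \<Rightarrow> real \<Rightarrow> real \<Rightarrow> 'a::euclidean_space \<Rightarrow> 'a \<Rightarrow> real" where
  "gain l m \<alpha> u v =
     l * (2 - l) * (norm u)\<^sup>2 + m * (2 - m) * (norm v)\<^sup>2 + (1 - \<alpha>) * (norm (l *\<^sub>R u + m *\<^sub>R v))\<^sup>2"

text \<open>With \<open>d = x - c\<close> the vectors \<open>d - u\<close> and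
  \<open>d - l *\<^sub>R u - v\<close> are \<open>p - c\<close> and \<open>q - c\<close>. The two
  inner products thus pair a normal vector with the displacement from a common point
  \<open>c\<close>, and they are nonnegative for convex sets.\<close>

lemma norm_step_eq:
  fixes d u v :: "'a::euclidean_space"
  shows "(norm (d - \<alpha> *\<^sub>R (l *\<^sub>R u + m *\<^sub>R v)))\<^sup>2 = (norm d)\<^sup>2 - \<alpha> * gain l m \<alpha> u v
     - 2 * \<alpha> * (l * (u \<bullet> (d - u)) + m * (v \<bullet> (d - l *\<^sub>R u - v)))"
proof -
  have sub: "(norm (a - t *\<^sub>R b))\<^sup>2 = (norm a)\<^sup>2 - 2 * t * (a \<bullet> b) + t\<^sup>2 * (norm b)\<^sup>2" for a b :: 'a and t
    unfolding power2_norm_eq_inner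
    by (simp add: inner_diff_left inner_diff_right inner_commute power2_eq_square)
  have add: "(norm (l *\<^sub>R u + m *\<^sub>R v))\<^sup>2 = l\<^sup>2 * (norm u)\<^sup>2 + 2 * l * m * (u \<bullet> v) + m\<^sup>2 * (norm v)\<^sup>2"
    unfolding power2_norm_eq_inner
    by (simp add: inner_add_left inner_add_right inner_commute power2_eq_square)
  have "u \<bullet> (d - u) = d \<bullet> u - (norm u)\<^sup>2" "v \<bullet> (d - l *\<^sub>R u - v) = d \<bullet> v - l * (u \<bullet> v) - (norm v)\<^sup>2"
    by (simp_all add: inner_diff_right inner_commute power2_norm_eq_inner)
  moreover have "d \<bullet> (l *\<^sub>R u + m *\<^sub>R v) = l * (d \<bullet> u) + m * (d \<bullet> v)"
    by (simp add: inner_add_right)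
  ultimately show ?thesis
    unfolding gain_def sub add by (simp only:) (simp add: algebra_simps power2_eq_square)
qed

text \<open>The error \<open>e\<close> is 0 for convex sets and a small multiple of the squared
  distance to \<open>A \<inter> B\<close> for superregular ones. The factor 8 is the largest value
  of \<open>2 * (l + m)\<close>.\<close>

lemma norm_step_le:
  fixes d u v :: "'a::euclidean_space"
  assumes "0 \<le> \<alpha>" "0 \<le> l" "l \<le> 2" "0 \<le> m" "m \<le> 2"
    and u: "u \<bullet> (d - u) \<ge> - e" and v: "v \<bullet> (d - l *\<^sub>R u - v) \<ge> - e" and "0 \<le> e"
  shows "(norm (d - \<alpha> *\<^sub>R (l *\<^sub>R u + m *\<^sub>R v)))\<^sup>2 \<le> (norm d)\<^sup>2 - \<alpha> * gain l m \<alpha> u v + 8 * \<alpha> * e"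
proof -
  have "l * (u \<bullet> (d - u)) \<ge> l * (- e)" "m * (v \<bullet> (d - l *\<^sub>R u - v)) \<ge> m * (- e)"
    using u v assms(2,4) by (simp_all only: mult_left_mono)
  moreover have "l * e \<le> 2 * e" "m * e \<le> 2 * e"
    using assms by (auto intro!: mult_right_mono)
  ultimately have "l * (u \<bullet> (d - u)) + m * (v \<bullet> (d - l *\<^sub>R u - v)) \<ge> - 4 * e"
    unfolding mult_minus_right by linarith
  then have "2 * \<alpha> * (l * (u \<bullet> (d - u)) + m * (v \<bullet> (d - l *\<^sub>R u - v))) \<ge> 2 * \<alpha> * (- 4 * e)"
    using \<open>0 \<le> \<alpha>\<close> by (intro mult_left_mono) auto
  then show ?thesis unfolding norm_step_eq by (simp add: algebra_simps)
qed

text \<open>A weighted Cauchy-Schwarz inequality; the difference of the two sides is a multiple of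
  the square of \<open>norm (s *\<^sub>R u - t *\<^sub>R v)\<close>. For \<open>s = 2 - l\<close>
  and \<open>t = 2 - m\<close> the first factor is the reciprocal of \<open>beta_hat l m\<close> and
  the second consists of the first two terms of the gain.\<close>

lemma norm_add_scaled_sq_le:
  fixes u v :: "'a::real_inner"
  assumes "0 < a" "0 < b" "0 < s" "0 < t"
  shows "(norm (a *\<^sub>R u + b *\<^sub>R v))\<^sup>2 \<le> (a / s + b / t) * (a * s * (norm u)\<^sup>2 + b * t * (norm v)\<^sup>2)"
proof -
  define p q r where "p = (norm u)\<^sup>2" "q = (norm v)\<^sup>2" "r = u \<bullet> v"
  have "(norm (a *\<^sub>R u + b *\<^sub>R v))\<^sup>2 = a * a * p + 2 * a * b * r + b * b * q"
    unfolding p_q_r_def power2_norm_eq_inner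
    by (simp add: inner_add_left inner_add_right inner_commute algebra_simps)
  moreover have "(norm (s *\<^sub>R u - t *\<^sub>R v))\<^sup>2 = s * s * p - 2 * s * t * r + t * t * q"
    unfolding p_q_r_def power2_norm_eq_inner
    by (simp add: inner_diff_left inner_diff_right inner_commute algebra_simps)
  moreover have "(a / s + b / t) * (a * s * p + b * t * q) - (a * a * p + 2 * a * b * r + b * b * q)
      = a * b / (s * t) * (s * s * p - 2 * s * t * r + t * t * q)"
    using assms by (simp add: field_simps)
  moreover have "a * b / (s * t) * (norm (s *\<^sub>R u - t *\<^sub>R v))\<^sup>2 \<ge> 0"
    using assms by simp
  ultimately show ?thesis by (simp add: p_q_r_def)
qed

text \<open>For \<open>m = 2\<close> the term in \<open>norm v\<close> disappears from the gain, so
  \<open>v\<close> is recovered from \<open>l *\<^sub>R u + 2 *\<^sub>R v\<close> and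
  \<open>u\<close> by the triangle inequality. The second bound is the mirrored case, in which the
  first relaxation parameter is 2.\<close>

lemma gain_bound_first_lt:
  assumes "0 < l" "l < 2" "0 < m" "m = 2" "\<alpha> < 1"
  obtains k where "0 < k" "\<And>u v :: 'a::euclidean_space. gain l m \<alpha> u v \<ge> k * ((norm u)\<^sup>2 + (norm v)\<^sup>2)"
    "\<And>u v :: 'a. gain m l \<alpha> v u \<ge> k * ((norm u)\<^sup>2 + (norm v)\<^sup>2)"
proof -
  define c where "c = min (l * (2 - l) / 2) (1 - \<alpha>)"
  have c: "0 < c" "c \<le> l * (2 - l) / 2" "c \<le> 1 - \<alpha>"
    unfolding c_def using assms by (simp_all only: min.cobounded1 min.cobounded2) simp_all
  have main: "gain l m \<alpha> u v \<ge> (c / 4) * ((norm u)\<^sup>2 + (norm v)\<^sup>2)" for u v :: 'a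
  proof -
    have 1: "(norm (2 *\<^sub>R v))\<^sup>2 \<le> 2 * (norm (l *\<^sub>R u + 2 *\<^sub>R v))\<^sup>2 + 2 * (norm (l *\<^sub>R u))\<^sup>2"
    proof -
      have "norm (2 *\<^sub>R v) \<le> norm (l *\<^sub>R u + 2 *\<^sub>R v) + norm (l *\<^sub>R u)"
        using norm_triangle_ineq4[of "l *\<^sub>R u + 2 *\<^sub>R v" "l *\<^sub>R u"] by simp
      then have "(norm (2 *\<^sub>R v))\<^sup>2 \<le> (norm (l *\<^sub>R u + 2 *\<^sub>R v) + norm (l *\<^sub>R u))\<^sup>2"
        by (intro power_mono) auto
      also have "\<dots> \<le> 2 * (norm (l *\<^sub>R u + 2 *\<^sub>R v))\<^sup>2 + 2 * (norm (l *\<^sub>R u))\<^sup>2"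
        using sum_squares_bound[of "norm (l *\<^sub>R u + 2 *\<^sub>R v)" "norm (l *\<^sub>R u)"]
        by (simp add: power2_sum)
      finally show ?thesis .
    qed
    have 2: "(norm (l *\<^sub>R u))\<^sup>2 \<le> 4 * (norm u)\<^sup>2"
      using assms power_mono[of l 2 2] by (auto simp: power_mult_distrib intro!: mult_right_mono)
    have "(norm v)\<^sup>2 \<le> (norm (l *\<^sub>R u + 2 *\<^sub>R v))\<^sup>2 / 2 + 2 * (norm u)\<^sup>2"
      using 1 2 by (simp add: power_mult_distrib)
    then have "(norm u)\<^sup>2 + (norm v)\<^sup>2 \<le> 4 * (norm (l *\<^sub>R u + 2 *\<^sub>R v))\<^sup>2 + 4 * (norm u)\<^sup>2"
      using zero_le_power2[of "norm u"] zero_le_power2[of "norm (l *\<^sub>R u + 2 *\<^sub>R v)"] by linarith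
    then have "(c / 4) * ((norm u)\<^sup>2 + (norm v)\<^sup>2) \<le>
        (c / 4) * (4 * (norm (l *\<^sub>R u + 2 *\<^sub>R v))\<^sup>2 + 4 * (norm u)\<^sup>2)"
      using c by (intro mult_left_mono) auto
    also have "\<dots> = c * (norm u)\<^sup>2 + c * (norm (l *\<^sub>R u + 2 *\<^sub>R v))\<^sup>2"
      by (simp add: algebra_simps)
    also have "\<dots> \<le> l * (2 - l) * (norm u)\<^sup>2 + (1 - \<alpha>) * (norm (l *\<^sub>R u + 2 *\<^sub>R v))\<^sup>2"
      using c assms by (intro add_mono mult_right_mono) (auto simp: field_simps)
    finally show ?thesis using assms by (simp add: gain_def)
  qed
  moreover have "gain m l \<alpha> v u = gain l m \<alpha> u v" for u v :: 'a
    by (simp add: gain_def add.commute)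
  ultimately show thesis using c(1) by (intro that[of "c / 4"]) auto
qed

lemma gain_bound:
  assumes "0 < l" "l \<le> 2" "0 < m" "m \<le> 2" "min l m < 2" "\<alpha> < 1 + beta_hat l m"
  obtains k where "0 < k"
    "\<And>u v :: 'a::euclidean_space. gain l m \<alpha> u v \<ge> k * ((norm u)\<^sup>2 + (norm v)\<^sup>2)"
proof -
  consider "l = 2" | "l < 2" "m = 2" | "l < 2" "m < 2" using assms by linarith
  then show thesis
  proof cases
    case 1
    then have lt: "m < 2" "\<alpha> < 1" using assms by (auto simp: beta_hat_def)
    show thesis
    proof (rule gain_bound_first_lt[OF \<open>0 < m\<close> lt(1) \<open>0 < l\<close> 1 lt(2)])
      fix k assume k: "0 < k" "\<And>u v :: 'a. gain l m \<alpha> v u \<ge> k * ((norm u)\<^sup>2 + (norm v)\<^sup>2)"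
      have "gain l m \<alpha> u v \<ge> k * ((norm u)\<^sup>2 + (norm v)\<^sup>2)" for u v :: 'a
        using k(2)[of v u] by (simp only: add.commute)
      then show thesis by (rule that[OF k(1)])
    qed
  next
    case 2
    then have lt: "\<alpha> < 1" using assms by (auto simp: beta_hat_def)
    show thesis
    proof (rule gain_bound_first_lt[OF \<open>0 < l\<close> 2(1) \<open>0 < m\<close> 2(2) lt])
      fix k assume "0 < k" "\<And>u v :: 'a. gain l m \<alpha> u v \<ge> k * ((norm u)\<^sup>2 + (norm v)\<^sup>2)"
      then show thesis by (rule that)
    qed
  next
    case 3
    define K where "K = l / (2 - l) + m / (2 - m)"
    have K: "0 < K" unfolding K_def using 3 assms by (intro add_pos_pos divide_pos_pos) simp_all
    have beta: "beta_hat l m = 1 / K"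
      using 3 unfolding beta_hat_def K_def by (simp add: inverse_eq_divide)
    \<comment> \<open>\<open>c\<close> is the share of \<open>W\<close> that survives the term
      \<open>(1 - \<alpha>) * N\<close>. For \<open>\<alpha> \<le> 1\<close> that term is
      nonnegative; otherwise it costs at most \<open>(\<alpha> - 1) * K * W\<close>, and
      \<open>(\<alpha> - 1) * K < 1\<close> is exactly the assumed bound on
      \<open>\<alpha>\<close>.\<close>
    define c where "c = min 1 (1 + (1 - \<alpha>) * K)"
    have "(\<alpha> - 1) * K < 1" using K assms(6) unfolding beta by (simp add: pos_less_divide_eq[symmetric])
    then have c: "0 < c" by (simp add: c_def algebra_simps)
    define k where "k = c * min (l * (2 - l)) (m * (2 - m))"
    have k: "0 < k" unfolding k_def using 3 assms c by (intro mult_pos_pos) simp_all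
    have "gain l m \<alpha> u v \<ge> k * ((norm u)\<^sup>2 + (norm v)\<^sup>2)" for u v :: 'a
    proof -
      define W where "W = l * (2 - l) * (norm u)\<^sup>2 + m * (2 - m) * (norm v)\<^sup>2"
      define N where "N = (norm (l *\<^sub>R u + m *\<^sub>R v))\<^sup>2"
      have N: "0 \<le> N" "N \<le> K * W"
        using norm_add_scaled_sq_le[of l m "2 - l" "2 - m" u v] assms 3
        unfolding N_def W_def K_def by simp_all
      have W0: "0 \<le> W" unfolding W_def using 3 assms by (intro add_nonneg_nonneg mult_nonneg_nonneg) simp_all
      have "c * W \<le> W + (1 - \<alpha>) * N"
      proof (cases "\<alpha> \<le> 1")
        case True
        have "c * W \<le> 1 * W" using W0 by (intro mult_right_mono) (auto simp: c_def)
        then show ?thesis using mult_nonneg_nonneg[OF _ N(1), of "1 - \<alpha>"] True by linarith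
      next
        case False
        have "(1 - \<alpha>) * (K * W) \<le> (1 - \<alpha>) * N" by (rule mult_left_mono_neg[OF N(2)]) (use False in simp)
        moreover have "c * W \<le> (1 + (1 - \<alpha>) * K) * W" using W0 by (intro mult_right_mono) (auto simp: c_def)
        moreover have "(1 + (1 - \<alpha>) * K) * W = W + (1 - \<alpha>) * (K * W)" by (simp add: algebra_simps)
        ultimately show ?thesis by linarith
      qed
      moreover have "min (l * (2 - l)) (m * (2 - m)) * ((norm u)\<^sup>2 + (norm v)\<^sup>2) \<le> W"
        unfolding W_def distrib_left by (rule add_mono; rule mult_right_mono) simp_all
      then have "k * ((norm u)\<^sup>2 + (norm v)\<^sup>2) \<le> c * W"
        unfolding k_def mult.assoc by (rule mult_left_mono) (use c in simp)
      moreover have "gain l m \<alpha> u v = W + (1 - \<alpha>) * N" by (simp add: gain_def W_def N_def)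
      ultimately show ?thesis by linarith
    qed
    then show thesis using k that by blast
  qed
qed

lemma gain_reflections:
  "gain 2 2 \<alpha> u v = 4 * (1 - \<alpha>) * (norm (u + v))\<^sup>2"
proof -
  have "norm (2 *\<^sub>R u + 2 *\<^sub>R v) = 2 * norm (u + v)"
    by (metis norm_scaleR scaleR_add_right abs_numeral)
  then show ?thesis by (simp only: gain_def power_mult_distrib) simp
qed

section \<open>Linear convergence of sequences\<close>

lemma geometric_steps_converge:
  fixes x :: "nat \<Rightarrow> 'a::euclidean_space"
  assumes \<rho>: "0 \<le> \<rho>" "\<rho> < 1" and step: "\<And>n. norm (x (Suc n) - x n) \<le> K * \<rho> ^ n"
  obtains y where "x \<longlonglongrightarrow> y" "\<And>n. norm (x n - y) \<le> K / (1 - \<rho>) * \<rho> ^ n"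
proof -
  have "summable (\<lambda>n. K * \<rho> ^ n)" using \<rho> by (intro summable_mult summable_geometric) auto
  then have "summable (\<lambda>n. x (Suc n) - x n)"
    by (rule summable_comparison_test'[of _ 0]) (rule step)
  then have "(\<lambda>k. \<Sum>n<k. x (Suc n) - x n) \<longlonglongrightarrow> (\<Sum>n. x (Suc n) - x n)"
    by (rule summable_LIMSEQ)
  then have "(\<lambda>k. (x k - x 0) + x 0) \<longlonglongrightarrow> (\<Sum>n. x (Suc n) - x n) + x 0"
    unfolding sum_lessThan_telescope by (intro tendsto_add tendsto_const)
  then obtain y where y: "x \<longlonglongrightarrow> y" by auto
  have K: "0 \<le> K" using order_trans[OF norm_ge_zero step[of 0]] by simp
  \<comment> \<open>Keeping the exact partial sum of the geometric series, and not just its limit,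
    lets the induction close.\<close>
  have bd: "norm (x (n + k) - x n) \<le> K * \<rho> ^ n * (1 - \<rho> ^ k) / (1 - \<rho>)" for n k
  proof (induction k)
    case (Suc k)
    have "norm (x (n + Suc k) - x n) \<le> norm (x (Suc (n + k)) - x (n + k)) + norm (x (n + k) - x n)"
      using norm_triangle_ineq[of "x (Suc (n + k)) - x (n + k)" "x (n + k) - x n"] by simp
    also have "\<dots> \<le> K * \<rho> ^ (n + k) + K * \<rho> ^ n * (1 - \<rho> ^ k) / (1 - \<rho>)"
      using Suc step by (intro add_mono) auto
    also have "\<dots> = K * \<rho> ^ n * (1 - \<rho> ^ Suc k) / (1 - \<rho>)"
      using \<rho> by (simp add: field_simps power_add)
    finally show ?case .
  qed auto
  have "norm (x n - y) \<le> K / (1 - \<rho>) * \<rho> ^ n" for n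
  proof (rule LIMSEQ_le_const2)
    have "(\<lambda>k. x (k + n)) \<longlonglongrightarrow> y" using y by (rule LIMSEQ_ignore_initial_segment)
    then show "(\<lambda>k. norm (x n - x (k + n))) \<longlonglongrightarrow> norm (x n - y)"
      by (intro tendsto_intros)
    have "norm (x n - x (k + n)) \<le> K / (1 - \<rho>) * \<rho> ^ n" for k
    proof -
      have "norm (x n - x (k + n)) \<le> K * \<rho> ^ n * (1 - \<rho> ^ k) / (1 - \<rho>)"
        using bd[of n k] by (simp add: norm_minus_commute add.commute)
      also have "\<dots> \<le> K * \<rho> ^ n * 1 / (1 - \<rho>)"
        using \<rho> K by (intro divide_right_mono mult_left_mono) auto
      finally show ?thesis by simp
    qed
    then show "\<exists>N. \<forall>k\<ge>N. norm (x n - x (k + n)) \<le> K / (1 - \<rho>) * \<rho> ^ n" by blast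
  qed
  then show thesis using that y by blast
qed

lemma R_linear_conv_tendsto:
  assumes "R_linear_conv x y" shows "x \<longlonglongrightarrow> y"
proof -
  obtain \<rho> \<sigma> where r: "0 \<le> \<rho>" "\<rho> < 1" "\<And>n. norm (x n - y) \<le> \<sigma> * \<rho> ^ n"
    using assms by (auto simp: R_linear_conv_def)
  have "(\<lambda>n. \<sigma> * \<rho> ^ n) \<longlonglongrightarrow> 0"
    using r by (intro tendsto_mult_right_zero LIMSEQ_power_zero) auto
  then have "(\<lambda>n. x n - y) \<longlonglongrightarrow> 0"
    by (rule Lim_null_comparison[rotated]) (simp add: r)
  then show ?thesis by (simp add: LIM_zero_iff)
qed

lemma R_linear_conv_shift:
  assumes "R_linear_conv (\<lambda>n. x (n + N)) y" shows "R_linear_conv x y"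
proof -
  obtain \<rho> \<sigma> where r: "0 \<le> \<rho>" "\<rho> < 1" "0 \<le> \<sigma>" "\<And>n. norm (x (n + N) - y) \<le> \<sigma> * \<rho> ^ n"
    using assms by (auto simp: R_linear_conv_def)
  \<comment> \<open>the rate is enlarged to be positive, so that it can be divided out of the first \<open>N\<close> terms\<close>
  define s where "s = max \<rho> (1 / 2)"
  have s: "0 < s" "s < 1" "\<rho> \<le> s" using r by (auto simp: s_def)
  define K where "K = \<sigma> / s ^ N + (\<Sum>i<N. norm (x i - y) / s ^ i)"
  have "norm (x n - y) \<le> K * s ^ n" for n
  proof (cases "n < N")
    case True
    have "norm (x n - y) / s ^ n \<le> (\<Sum>i<N. norm (x i - y) / s ^ i)"
      using True s by (intro member_le_sum) auto
    also have "\<dots> \<le> K" using r s by (simp add: K_def)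
    finally show ?thesis using s by (simp add: field_simps)
  next
    case False
    then obtain k where n: "n = k + N" by (metis add.commute le_Suc_ex not_less)
    have "norm (x n - y) \<le> \<sigma> * \<rho> ^ k" using r n by auto
    also have "\<dots> \<le> \<sigma> * s ^ k" using r s by (intro mult_left_mono power_mono) auto
    also have "\<dots> = \<sigma> / s ^ N * s ^ n" using s by (simp add: n power_add)
    also have "\<dots> \<le> K * s ^ n" using s by (intro mult_right_mono) (auto simp: K_def intro!: sum_nonneg)
    finally show ?thesis .
  qed
  moreover have "0 \<le> K" using r s by (auto simp: K_def intro!: add_nonneg_nonneg sum_nonneg)
  ultimately show ?thesis unfolding R_linear_conv_def using s by (intro exI[of _ s] exI[of _ K]) auto
qed

text \<open>The estimates are available only in the ball of radius \<open>R\<close> about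
  \<open>w\<close>, so decay and confinement must be proved in one induction: the path has total
  length at most \<open>C / (1 - \<rho>) * g 0\<close>, and \<open>x0\<close> reserves that much
  room. The merit \<open>g\<close> is left abstract because it is the distance to
  \<open>A \<inter> B\<close> for the algorithm and the distance to \<open>A\<close> for alternating
  projections.\<close>

lemma merit_decrease_converges:
  fixes x :: "nat \<Rightarrow> 'a::euclidean_space" and g :: "nat \<Rightarrow> real"
  assumes \<rho>: "0 \<le> \<rho>" "\<rho> < 1" and C: "0 \<le> C" and g: "0 \<le> g 0"
    and step: "\<And>n. norm (x n - w) \<le> R \<Longrightarrow> g (Suc n) \<le> \<rho> * g n \<and> norm (x (Suc n) - x n) \<le> C * g n"
    and x0: "norm (x 0 - w) + C / (1 - \<rho>) * g 0 \<le> R"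
  obtains y where "\<And>n. norm (x n - y) \<le> C / (1 - \<rho>) * g 0 * \<rho> ^ n" "\<And>n. g n \<le> \<rho> ^ n * g 0"
proof -
  define d where "d = g 0"
  have d: "0 \<le> d" using g by (simp add: d_def)
  have main: "norm (x n - x 0) \<le> C * d * (1 - \<rho> ^ n) / (1 - \<rho>) \<and> g n \<le> \<rho> ^ n * d
      \<and> norm (x n - w) \<le> R" for n
  proof (induction n)
    case 0
    have "0 \<le> C / (1 - \<rho>) * g 0" using C \<rho> g by auto
    then show ?case using x0 by (simp add: d_def)
  next
    case (Suc n)
    have s: "g (Suc n) \<le> \<rho> * g n" "norm (x (Suc n) - x n) \<le> C * g n"
      using step Suc by auto
    have 1: "g (Suc n) \<le> \<rho> ^ Suc n * d"
      using s(1) mult_left_mono[of "g n" "\<rho> ^ n * d" \<rho>] Suc \<rho> by auto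
    have "C * g n \<le> C * (\<rho> ^ n * d)" using Suc C by (intro mult_left_mono) auto
    then have "norm (x (Suc n) - x 0) \<le> C * (\<rho> ^ n * d) + C * d * (1 - \<rho> ^ n) / (1 - \<rho>)"
      using norm_triangle_ineq[of "x (Suc n) - x n" "x n - x 0"] s(2) Suc by auto
    also have "\<dots> = C * d * (1 - \<rho> ^ Suc n) / (1 - \<rho>)"
      using \<rho> by (simp add: field_simps)
    finally have 2: "norm (x (Suc n) - x 0) \<le> C * d * (1 - \<rho> ^ Suc n) / (1 - \<rho>)" .
    also have "\<dots> \<le> C * d * 1 / (1 - \<rho>)"
      using \<rho> C d zero_le_power[OF \<rho>(1), of "Suc n"] by (intro divide_right_mono mult_left_mono) auto
    finally have "norm (x (Suc n) - w) \<le> norm (x 0 - w) + C / (1 - \<rho>) * g 0"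
      using norm_triangle_ineq[of "x (Suc n) - x 0" "x 0 - w"] by (simp add: d_def)
    then show ?case using 1 2 x0 by auto
  qed
  have "norm (x (Suc n) - x n) \<le> (C * d) * \<rho> ^ n" for n
    using step[of n] main[of n] mult_left_mono[of "g n" "\<rho> ^ n * d" C] C
    by (auto simp: algebra_simps)
  then obtain y where y: "\<And>n. norm (x n - y) \<le> C * d / (1 - \<rho>) * \<rho> ^ n"
    using geometric_steps_converge[OF \<rho>] by metis
  show thesis using that[of y] y main by (simp add: d_def)
qed

lemma limit_mem_of_infdist_decay:
  fixes x :: "nat \<Rightarrow> 'a::euclidean_space"
  assumes "closed S" "S \<noteq> {}" "x \<longlonglongrightarrow> y" and \<rho>: "0 \<le> \<rho>" "\<rho> < 1"
    and "\<And>n. infdist (x n) S \<le> \<rho> ^ n * d"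
  shows "y \<in> S"
proof -
  have lim: "(\<lambda>n. \<rho> ^ n * d) \<longlonglongrightarrow> 0"
    using \<rho> by (intro tendsto_mult_left_zero LIMSEQ_power_zero) auto
  have "(\<lambda>n. infdist (x n) S) \<longlonglongrightarrow> 0"
    by (rule Lim_null_comparison[OF _ lim]) (simp add: assms infdist_nonneg)
  moreover have "(\<lambda>n. infdist (x n) S) \<longlonglongrightarrow> infdist y S" by (intro tendsto_infdist assms)
  ultimately have "infdist y S = 0" using LIMSEQ_unique by blast
  then show ?thesis using assms(1,2) in_closed_iff_infdist_zero by auto
qed

lemma infdist_decrease_R_linear_conv:
  fixes x :: "nat \<Rightarrow> 'a::euclidean_space"
  assumes S: "closed S" "w \<in> S" and \<rho>: "0 \<le> \<rho>" "\<rho> < 1" and C: "0 \<le> C"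
    and step: "\<And>n. norm (x n - w) \<le> R \<Longrightarrow>
      infdist (x (Suc n)) S \<le> \<rho> * infdist (x n) S \<and> norm (x (Suc n) - x n) \<le> C * infdist (x n) S"
    and x0: "norm (x 0 - w) * (1 + C / (1 - \<rho>)) \<le> R"
  shows "\<exists>y\<in>S. R_linear_conv x y"
proof -
  define d where "d = infdist (x 0) S"
  have d: "0 \<le> d" "d \<le> norm (x 0 - w)"
    using infdist_nonneg infdist_le[OF S(2), of "x 0"] by (auto simp: d_def dist_norm)
  have "C / (1 - \<rho>) * d \<le> C / (1 - \<rho>) * norm (x 0 - w)"
    using C \<rho> d by (intro mult_left_mono) auto
  then have "norm (x 0 - w) + C / (1 - \<rho>) * infdist (x 0) S \<le> R"
    using x0 by (simp add: d_def algebra_simps)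
  then obtain y where y: "\<And>n. norm (x n - y) \<le> C / (1 - \<rho>) * d * \<rho> ^ n" "\<And>n. infdist (x n) S \<le> \<rho> ^ n * d"
    using merit_decrease_converges[OF \<rho> C, of "\<lambda>n. infdist (x n) S" x w R] step
    by (metis d_def infdist_nonneg)
  have R: "R_linear_conv x y"
    unfolding R_linear_conv_def using \<rho> y(1) C d
    by (intro exI[of _ \<rho>] exI[of _ "C / (1 - \<rho>) * d"]) auto
  have "y \<in> S"
    using limit_mem_of_infdist_decay[OF S(1) _ R_linear_conv_tendsto[OF R] \<rho> y(2)] S(2) by blast
  then show ?thesis using R by blast
qed

section \<open>Local convergence for superregular sets\<close>

definition admissible :: "real \<Rightarrow> real \<Rightarrow> real \<Rightarrow> bool" where
  "admissible l m \<alpha> \<longleftrightarrow> 0 < l \<and> l \<le> 2 \<and> 0 < m \<and> m \<le> 2 \<and> 0 < \<alpha> \<and> \<alpha> < 1 + beta_hat l m"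

text \<open>The common interface of the two regimes. \<open>M\<close> is \<open>UNIV\<close> when
  \<open>min l m < 2\<close>; for \<open>l = m = 2\<close> it is the affine hull of
  \<open>A \<union> B\<close>, since the angle bound on normals concerns only vectors parallel to
  it.\<close>

definition gain_coercive_near ::
  "'a::euclidean_space set \<Rightarrow> 'a set \<Rightarrow> real \<Rightarrow> real \<Rightarrow> real \<Rightarrow> 'a \<Rightarrow> 'a set \<Rightarrow> bool" where
  "gain_coercive_near A B l m \<alpha> w M \<longleftrightarrow>
     (\<exists>k>0. \<exists>\<delta>>0. \<forall>x \<in> M \<inter> cball w \<delta>. \<forall>p \<in> proj A x. \<forall>q \<in> proj B (x - l *\<^sub>R (x - p)).
        gain l m \<alpha> (x - p) (x - l *\<^sub>R (x - p) - q)
          \<ge> k * ((norm (x - p))\<^sup>2 + (norm (x - l *\<^sub>R (x - p) - q))\<^sup>2))"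

lemma superregularD:
  assumes "superregular S w" "0 < \<epsilon>"
  obtains \<delta> where "0 < \<delta>"
    "\<And>p c z. p \<in> proj S z \<Longrightarrow> norm (p - w) \<le> \<delta> \<Longrightarrow> c \<in> S \<Longrightarrow> norm (c - w) \<le> \<delta> \<Longrightarrow>
       (z - p) \<bullet> (p - c) \<ge> - \<epsilon> * norm (z - p) * norm (p - c)"
proof -
  obtain \<delta> where d: "0 < \<delta>" "\<forall>x \<in> S \<inter> cball w \<delta>. \<forall>y \<in> S \<inter> cball w \<delta>. \<forall>u \<in> prox_normal_cone S x.
        u \<bullet> (x - y) \<ge> - \<epsilon> * norm u * norm (x - y)"
    using assms unfolding superregular_def by blast
  show thesis
  proof (rule that[OF d(1)])
    fix p c z assume a: "p \<in> proj S z" "norm (p - w) \<le> \<delta>" "c \<in> S" "norm (c - w) \<le> \<delta>"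
    then have "p \<in> S \<inter> cball w \<delta>" "c \<in> S \<inter> cball w \<delta>"
      using projD(1) by (auto simp: dist_norm norm_minus_commute)
    then show "(z - p) \<bullet> (p - c) \<ge> - \<epsilon> * norm (z - p) * norm (p - c)"
      using d(2) prox_normal_coneI[OF a(1)] by blast
  qed
qed

text \<open>Let \<open>d\<close> be the distance of \<open>x\<close> to \<open>A \<inter> B\<close>.
  Both residuals are of order \<open>d\<close>, so superregularity leaves an error of order
  \<open>\<epsilon>\<close> times \<open>d\<close> squared. Coercivity and linear regularity bound
  the gain below by a fixed multiple of \<open>d\<close> squared, and \<open>\<epsilon>\<close> is
  chosen so that the error uses up half of it.\<close>

lemma superregular_step:
  fixes A B :: "'a::euclidean_space set"
  assumes cl: "closed A" "closed B" and w: "w \<in> A \<inter> B" and adm: "admissible l m \<alpha>"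
    and sr: "superregular A w" "superregular B w" and lr: "linearly_regular_around A B w"
    and gc: "gain_coercive_near A B l m \<alpha> w M"
  obtains R \<rho> C where "0 < R" "0 \<le> \<rho>" "\<rho> < 1" "0 \<le> C"
    "\<And>x x'. x \<in> M \<Longrightarrow> norm (x - w) \<le> R \<Longrightarrow> x' \<in> alg_op A B l m \<alpha> x \<Longrightarrow>
      infdist x' (A \<inter> B) \<le> \<rho> * infdist x (A \<inter> B) \<and> norm (x' - x) \<le> C * infdist x (A \<inter> B)"
proof -
  have par: "0 < l" "l \<le> 2" "0 < m" "m \<le> 2" "0 < \<alpha>" using adm by (auto simp: admissible_def)
  obtain \<delta>0 \<kappa> where lr: "0 < \<delta>0" "0 < \<kappa>"
    "\<And>x. norm (x - w) \<le> \<delta>0 \<Longrightarrow> infdist x (A \<inter> B) \<le> \<kappa> * max (infdist x A) (infdist x B)"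
    using lr unfolding linearly_regular_around_def linearly_regular_on_def
    by (auto simp: dist_norm norm_minus_commute)
  obtain k \<delta>1 where gc: "0 < k" "0 < \<delta>1"
    "\<And>x p q. x \<in> M \<Longrightarrow> norm (x - w) \<le> \<delta>1 \<Longrightarrow> p \<in> proj A x \<Longrightarrow> q \<in> proj B (x - l *\<^sub>R (x - p)) \<Longrightarrow>
        gain l m \<alpha> (x - p) (x - l *\<^sub>R (x - p) - q)
          \<ge> k * ((norm (x - p))\<^sup>2 + (norm (x - l *\<^sub>R (x - p) - q))\<^sup>2)"
    using gc unfolding gain_coercive_near_def by (auto simp: dist_norm norm_minus_commute)
  \<comment> \<open>Linear regularity will give
    \<open>d \<le> \<kappa> * (2 * norm u + norm v)\<close>, whose square is at most 5 times
    \<open>\<kappa>\<close> squared times the sum of squares. Hence the gain is at least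
    \<open>2 * h\<close> times \<open>d\<close> squared. In \<open>\<epsilon>\<close> the divisor
    144 is 8 from \<open>norm_step_le\<close> times the 18 of \<open>e1\<close> and
    \<open>e2\<close>.\<close>
  define h where "h = k / (10 * \<kappa>\<^sup>2)"
  have h: "0 < h" using gc lr by (simp add: h_def)
  define \<epsilon> where "\<epsilon> = h / 144"
  have eps: "0 < \<epsilon>" using h by (simp add: \<epsilon>_def)
  obtain \<delta>A where dA: "0 < \<delta>A"
    "\<And>p c z. p \<in> proj A z \<Longrightarrow> norm (p - w) \<le> \<delta>A \<Longrightarrow> c \<in> A \<Longrightarrow> norm (c - w) \<le> \<delta>A \<Longrightarrow>
       (z - p) \<bullet> (p - c) \<ge> - \<epsilon> * norm (z - p) * norm (p - c)"
    using superregularD[OF sr(1) eps] by metis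
  obtain \<delta>B where dB: "0 < \<delta>B"
    "\<And>p c z. p \<in> proj B z \<Longrightarrow> norm (p - w) \<le> \<delta>B \<Longrightarrow> c \<in> B \<Longrightarrow> norm (c - w) \<le> \<delta>B \<Longrightarrow>
       (z - p) \<bullet> (p - c) \<ge> - \<epsilon> * norm (z - p) * norm (p - c)"
    using superregularD[OF sr(2) eps] by metis
  \<comment> \<open>From \<open>x\<close> within \<open>R\<close> of \<open>w\<close>, the second
    projection can end up as far as \<open>6 * R\<close> from \<open>w\<close>.\<close>
  define R where "R = min (min \<delta>0 \<delta>1) (min \<delta>A \<delta>B / 6)"
  have R: "0 < R" "R \<le> \<delta>0" "R \<le> \<delta>1" "6 * R \<le> \<delta>A" "6 * R \<le> \<delta>B"
    using lr gc dA dB unfolding R_def by (auto simp: min_def)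
  define \<rho> where "\<rho> = sqrt (max 0 (1 - \<alpha> * h))"
  have "0 < \<alpha> * h" using par h by simp
  then have \<rho>: "0 \<le> \<rho>" "\<rho> < 1" "\<rho>\<^sup>2 \<ge> 1 - \<alpha> * h" by (auto simp: \<rho>_def)
  show thesis
  proof (rule that[OF R(1) \<rho>(1,2), of "8 * \<alpha>"])
    show "0 \<le> 8 * \<alpha>" using par by simp
    fix x x' assume x: "x \<in> M" "norm (x - w) \<le> R" "x' \<in> alg_op A B l m \<alpha> x"
    obtain p q where p: "p \<in> proj A x" and q: "q \<in> proj B (x - l *\<^sub>R (x - p))"
      and x': "x' = x - \<alpha> *\<^sub>R (l *\<^sub>R (x - p) + m *\<^sub>R (x - l *\<^sub>R (x - p) - q))"
      using x(3) unfolding alg_op_iff by blast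
    define u where "u = x - p"
    define r where "r = x - l *\<^sub>R u"
    define v where "v = r - q"
    have "closed (A \<inter> B)" "A \<inter> B \<noteq> {}" using cl w by auto
    then obtain c where c: "c \<in> proj (A \<inter> B) x" using proj_nonempty by blast
    define d where "d = infdist x (A \<inter> B)"
    have xc: "norm (x - c) = d" "c \<in> A" "c \<in> B" using projD[OF c] by (auto simp: d_def)
    have d0: "0 \<le> d" by (simp add: d_def infdist_nonneg)
    have dR: "d \<le> R" using projD(3)[OF c w] xc x by simp
    have u_d: "norm u \<le> d" using projD(3)[OF p xc(2)] xc by (simp add: u_def)
    have lu: "norm (l *\<^sub>R u) \<le> 2 * norm u" using par by (auto intro!: mult_right_mono)
    have rc: "norm (r - c) \<le> 3 * d"
      using norm_triangle_ineq4[of "x - c" "l *\<^sub>R u"] lu u_d xc by (simp add: r_def algebra_simps)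
    have v_d: "norm v \<le> 3 * d" using projD(3)[of q B r c] q xc rc by (simp add: v_def r_def u_def)
    have qc: "norm (q - c) \<le> 6 * d"
      using norm_triangle_ineq4[of "r - c" v] rc v_d by (simp add: v_def)
    have pc: "norm (p - c) \<le> 2 * d"
      using norm_triangle_ineq4[of "x - c" u] u_d xc by (simp add: u_def)
    have pw: "norm (p - w) \<le> 2 * R"
      using norm_triangle_ineq4[of "x - w" u] u_d x(2) dR by (simp add: u_def)
    have rw: "norm (r - w) \<le> 3 * R"
      using norm_triangle_ineq4[of "x - w" "l *\<^sub>R u"] lu u_d x(2) dR by (simp add: r_def algebra_simps)
    have "norm v \<le> norm (r - w)" using projD(3)[of q B r w] q w by (simp add: v_def r_def u_def)
    then have qw: "norm (q - w) \<le> 6 * R"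
      using norm_triangle_ineq4[of "r - w" v] rw by (simp add: v_def)
    have cw: "norm (c - w) \<le> 2 * R"
      using norm_triangle_ineq4[of "x - w" "x - c"] x(2) dR xc by simp
    have e1: "u \<bullet> ((x - c) - u) \<ge> - (18 * \<epsilon> * d\<^sup>2)"
    proof -
      have "u \<bullet> (p - c) \<ge> - \<epsilon> * norm u * norm (p - c)"
        unfolding u_def using p pw cw xc R by (intro dA(2)) auto
      moreover have "norm u * norm (p - c) \<le> d * (2 * d)"
        using u_d pc d0 by (intro mult_mono) auto
      then have "norm u * norm (p - c) \<le> 18 * d\<^sup>2"
        unfolding power2_eq_square using mult_nonneg_nonneg[OF d0 d0] by linarith
      then have "\<epsilon> * (norm u * norm (p - c)) \<le> \<epsilon> * (18 * d\<^sup>2)"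
        using eps by (intro mult_left_mono) auto
      ultimately show ?thesis by (simp add: u_def algebra_simps)
    qed
    have e2: "v \<bullet> ((x - c) - l *\<^sub>R u - v) \<ge> - (18 * \<epsilon> * d\<^sup>2)"
    proof -
      have "v \<bullet> (q - c) \<ge> - \<epsilon> * norm v * norm (q - c)"
        unfolding v_def using q qw cw xc R by (intro dB(2)) (auto simp: r_def u_def)
      moreover have "norm v * norm (q - c) \<le> (3 * d) * (6 * d)"
        using v_d qc d0 by (intro mult_mono) auto
      then have "\<epsilon> * (norm v * norm (q - c)) \<le> \<epsilon> * (18 * d\<^sup>2)"
        using eps by (intro mult_left_mono) (auto simp: power2_eq_square)
      moreover have "(x - c) - l *\<^sub>R u - v = q - c" by (simp add: v_def r_def)
      ultimately show ?thesis by (simp add: algebra_simps)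
    qed
    have "(norm (x' - c))\<^sup>2 \<le> d\<^sup>2 - \<alpha> * gain l m \<alpha> u v + 8 * \<alpha> * (18 * \<epsilon> * d\<^sup>2)"
    proof -
      have eq: "x' - c = (x - c) - \<alpha> *\<^sub>R (l *\<^sub>R u + m *\<^sub>R v)"
        by (simp add: x' u_def v_def r_def)
      show ?thesis
        unfolding eq using norm_step_le[OF _ _ _ _ _ e1 e2, of \<alpha> m] par eps xc by simp
    qed
    also have "8 * \<alpha> * (18 * \<epsilon> * d\<^sup>2) = \<alpha> * (h * d\<^sup>2)" by (simp add: \<epsilon>_def)
    finally have 1: "(norm (x' - c))\<^sup>2 \<le> d\<^sup>2 - \<alpha> * gain l m \<alpha> u v + \<alpha> * (h * d\<^sup>2)" .
    have "h * d\<^sup>2 * 2 \<le> gain l m \<alpha> u v"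
    proof -
      \<comment> \<open>Both distances have the same bound: \<open>p\<close> is at distance
        \<open>norm u\<close> from \<open>x\<close>, while \<open>x - q\<close> equals
        \<open>l *\<^sub>R u + v\<close> with \<open>l \<le> 2\<close>.\<close>
      have "infdist x A \<le> 2 * norm u + norm v" using projD(2)[OF p] unfolding u_def by (smt (verit) norm_ge_zero)
      moreover have "infdist x B \<le> 2 * norm u + norm v"
      proof -
        have "infdist x B \<le> norm (x - q)"
          using infdist_le[OF projD(1)[OF q], of x] by (simp add: dist_norm)
        also have "x - q = l *\<^sub>R u + v" by (simp add: v_def r_def)
        finally show ?thesis using norm_triangle_ineq[of "l *\<^sub>R u" v] lu by linarith
      qed
      ultimately have "\<kappa> * max (infdist x A) (infdist x B) \<le> \<kappa> * (2 * norm u + norm v)"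
        using lr(2) by (intro mult_left_mono) auto
      then have "d \<le> \<kappa> * (2 * norm u + norm v)"
        using lr(3)[of x] x(2) R unfolding d_def by linarith
      then have "d\<^sup>2 \<le> (\<kappa> * (2 * norm u + norm v))\<^sup>2" using d0 by (intro power_mono) auto
      also have "\<dots> \<le> \<kappa>\<^sup>2 * (5 * ((norm u)\<^sup>2 + (norm v)\<^sup>2))"
      proof -
        have "0 \<le> (norm u - 2 * norm v)\<^sup>2" by simp
        then have "(2 * norm u + norm v)\<^sup>2 \<le> 5 * ((norm u)\<^sup>2 + (norm v)\<^sup>2)"
          by (simp add: power2_eq_square algebra_simps)
        then show ?thesis unfolding power_mult_distrib by (intro mult_left_mono) auto
      qed
      finally have "h * 2 * d\<^sup>2 \<le> h * 2 * (\<kappa>\<^sup>2 * (5 * ((norm u)\<^sup>2 + (norm v)\<^sup>2)))"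
        using h by (intro mult_left_mono) auto
      also have "\<dots> = k * ((norm u)\<^sup>2 + (norm v)\<^sup>2)" using lr(2) by (simp add: h_def)
      also have "\<dots> \<le> gain l m \<alpha> u v"
        using gc(3)[OF x(1) _ p q] x(2) R by (simp add: u_def v_def r_def)
      finally show ?thesis by (simp add: mult_ac)
    qed
    then have "\<alpha> * (h * d\<^sup>2 * 2) \<le> \<alpha> * gain l m \<alpha> u v" using par by (intro mult_left_mono) auto
    then have "(norm (x' - c))\<^sup>2 \<le> (1 - \<alpha> * h) * d\<^sup>2" using 1 by (simp add: algebra_simps)
    also have "\<dots> \<le> \<rho>\<^sup>2 * d\<^sup>2" using \<rho> by (intro mult_right_mono) auto
    finally have "norm (x' - c) \<le> \<rho> * d"
      using \<rho> d0 by (metis power_mult_distrib power2_le_imp_le mult_nonneg_nonneg)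
    moreover have "infdist x' (A \<inter> B) \<le> norm (x' - c)"
      using infdist_le[of c "A \<inter> B" x'] xc by (simp add: dist_norm)
    moreover have "norm (x' - x) \<le> 8 * \<alpha> * d"
    proof -
      have "norm (l *\<^sub>R u + m *\<^sub>R v) \<le> l * norm u + m * norm v"
        using norm_triangle_ineq[of "l *\<^sub>R u" "m *\<^sub>R v"] par by simp
      also have "\<dots> \<le> 2 * d + 2 * (3 * d)" using par u_d v_d d0 by (intro add_mono mult_mono) auto
      finally have "\<alpha> * norm (l *\<^sub>R u + m *\<^sub>R v) \<le> \<alpha> * (8 * d)" using par by (intro mult_left_mono) auto
      then show ?thesis using par by (simp add: x' u_def v_def r_def)
    qed
    ultimately show "infdist x' (A \<inter> B) \<le> \<rho> * infdist x (A \<inter> B) \<and>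
        norm (x' - x) \<le> 8 * \<alpha> * infdist x (A \<inter> B)"
      by (simp add: d_def)
  qed
qed

lemma superregular_local_convergence:
  fixes A B :: "'a::euclidean_space set"
  assumes cl: "closed A" "closed B" and w: "w \<in> A \<inter> B" and adm: "admissible l m \<alpha>"
    and sr: "superregular A w" "superregular B w" and lr: "linearly_regular_around A B w"
    and gc: "gain_coercive_near A B l m \<alpha> w M"
  obtains r where "0 < r"
    "\<And>x. norm (x 0 - w) \<le> r \<Longrightarrow> (\<And>n. x n \<in> M) \<Longrightarrow> (\<And>n. x (Suc n) \<in> alg_op A B l m \<alpha> (x n)) \<Longrightarrow>
       \<exists>y \<in> A \<inter> B. R_linear_conv x y"
proof -
  obtain R \<rho> C where R: "0 < R" "0 \<le> \<rho>" "\<rho> < 1" "0 \<le> C"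
    "\<And>x x'. x \<in> M \<Longrightarrow> norm (x - w) \<le> R \<Longrightarrow> x' \<in> alg_op A B l m \<alpha> x \<Longrightarrow>
      infdist x' (A \<inter> B) \<le> \<rho> * infdist x (A \<inter> B) \<and> norm (x' - x) \<le> C * infdist x (A \<inter> B)"
    using superregular_step[OF assms] by metis
  have pos: "0 < 1 + C / (1 - \<rho>)" using R by (auto intro!: add_pos_nonneg)
  show thesis
  proof (rule that[of "R / (1 + C / (1 - \<rho>))"])
    show "0 < R / (1 + C / (1 - \<rho>))" using R pos by simp
    fix x assume x: "norm (x 0 - w) \<le> R / (1 + C / (1 - \<rho>))" "\<And>n. x n \<in> M"
      "\<And>n. x (Suc n) \<in> alg_op A B l m \<alpha> (x n)"
    have "norm (x 0 - w) * (1 + C / (1 - \<rho>)) \<le> R" using x(1) pos pos_le_divide_eq by blast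
    then show "\<exists>y \<in> A \<inter> B. R_linear_conv x y"
      using infdist_decrease_R_linear_conv[of "A \<inter> B" w \<rho> C x R] cl w R x by auto
  qed
qed

lemma gain_coercive_near_UNIV:
  fixes A B :: "'a::euclidean_space set"
  assumes "admissible l m \<alpha>" "min l m < 2"
  shows "gain_coercive_near A B l m \<alpha> w UNIV"
proof -
  obtain k where "0 < k" "\<And>u v :: 'a. gain l m \<alpha> u v \<ge> k * ((norm u)\<^sup>2 + (norm v)\<^sup>2)"
    using gain_bound[where 'a='a, of l m \<alpha>] assms unfolding admissible_def by metis
  then show ?thesis unfolding gain_coercive_near_def by (intro exI[of _ k] exI[of _ 1]) auto
qed

section \<open>Affine-hull regularity\<close>

lemma mink_diff_singleton: "mink_diff S {w} = (\<lambda>x. x - w) ` S"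
  by (auto simp: mink_diff_def)

text \<open>Connects \<open>L - w\<close>, which occurs in affine-hull regularity, with
  \<open>L - L\<close>, whose orthogonal complement describes the limits.\<close>

lemma mink_diff_affine:
  fixes L :: "'a::euclidean_space set"
  assumes "affine L" "w \<in> L"
  shows "subspace (mink_diff L L)" "mink_diff L {w} = mink_diff L L"
proof -
  have sub: "subspace (mink_diff L {w})"
    unfolding mink_diff_singleton using assms by (rule affine_diffs_subspace_subtract)
  have "s - r \<in> mink_diff L {w}" if "s \<in> L" "r \<in> L" for s r
  proof -
    have "(s - w) - (r - w) \<in> mink_diff L {w}"
      by (rule subspace_diff[OF sub]) (use that in \<open>auto simp: mink_diff_singleton\<close>)
    then show ?thesis by simp
  qed
  then show "mink_diff L {w} = mink_diff L L"
    using assms(2) by (auto simp: mink_diff_def)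
  then show "subspace (mink_diff L L)" using sub by simp
qed

lemma limiting_normal_coneI:
  assumes "xs \<longlonglongrightarrow> x" "us \<longlonglongrightarrow> u" "\<And>n. xs n \<in> S" "\<And>n. us n \<in> prox_normal_cone S (xs n)"
  shows "u \<in> limiting_normal_cone S x"
  unfolding limiting_normal_cone_def using assms by blast

text \<open>The quantitative form of the regularity condition, by compactness: a limit
  \<open>(a, b)\<close> of normalised counterexamples satisfies \<open>a = - b\<close>, and
  \<open>a\<close> lies in all three sets that regularity intersects, so \<open>(a, b)\<close> would
  be 0 despite having norm 1.\<close>

lemma affine_hull_regular_angle:
  fixes A B :: "'a::euclidean_space set"
  assumes ahr: "affine_hull_regular A B w" and w: "w \<in> A \<inter> B"
    and V: "V = mink_diff (affine hull (A \<union> B)) (affine hull (A \<union> B))"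
  obtains k \<delta> where "0 < k" "0 < \<delta>"
    "\<And>p q u v. norm (p - w) \<le> \<delta> \<Longrightarrow> norm (q - w) \<le> \<delta> \<Longrightarrow> p \<in> A \<Longrightarrow> q \<in> B \<Longrightarrow>
       u \<in> prox_normal_cone A p \<Longrightarrow> v \<in> prox_normal_cone B q \<Longrightarrow> u \<in> V \<Longrightarrow> v \<in> V \<Longrightarrow>
       k * ((norm u)\<^sup>2 + (norm v)\<^sup>2) \<le> (norm (u + v))\<^sup>2"
proof (rule ccontr)
  assume neg: "\<not> thesis"
  have wL: "w \<in> affine hull (A \<union> B)" using w by (simp add: hull_inc)
  note V' = mink_diff_affine[OF affine_affine_hull wL, folded V]
  \<comment> \<open>One null sequence serves both as the radius and as the angle constant that is
    assumed to fail.\<close>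
  define e where "e n = inverse (real (Suc n))" for n
  have e0: "0 < e n" for n by (simp add: e_def)
  have "\<exists>p q u v. norm (p - w) \<le> e n \<and> norm (q - w) \<le> e n \<and> p \<in> A \<and> q \<in> B \<and>
       u \<in> prox_normal_cone A p \<and> v \<in> prox_normal_cone B q \<and> u \<in> V \<and> v \<in> V \<and>
       \<not> e n * ((norm u)\<^sup>2 + (norm v)\<^sup>2) \<le> (norm (u + v))\<^sup>2" for n
    using neg that[OF e0 e0, of n n] by blast
  then obtain p q u v where pq: "\<And>n. norm (p n - w) \<le> e n" "\<And>n. norm (q n - w) \<le> e n"
    "\<And>n. p n \<in> A" "\<And>n. q n \<in> B"
    and uv: "\<And>n. u n \<in> prox_normal_cone A (p n)" "\<And>n. v n \<in> prox_normal_cone B (q n)"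
      "\<And>n. u n \<in> V" "\<And>n. v n \<in> V"
    and lt: "\<And>n. (norm (u n + v n))\<^sup>2 < e n * ((norm (u n))\<^sup>2 + (norm (v n))\<^sup>2)"
    unfolding not_le by metis
  \<comment> \<open>The pair is normalised jointly in the product space, because one of
    \<open>u n\<close> and \<open>v n\<close> may be 0 or much smaller than the other.\<close>
  define t where "t n = inverse (norm (u n, v n))" for n
  have nz: "(u n, v n) \<noteq> 0" for n using lt[of n] by (auto simp: zero_prod_def)
  then have t0: "0 < t n" for n by (simp add: t_def)
  define z where "z n = t n *\<^sub>R (u n, v n)" for n
  have "norm (z n) = 1" for n using nz[of n] by (simp add: z_def t_def del: scaleR_Pair)
  then have "\<forall>n. z n \<in> sphere 0 1" by simp
  then obtain y s where y: "y \<in> sphere 0 1" "strict_mono s" "(z \<circ> s) \<longlonglongrightarrow> y"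
    using compact_sphere[of "0 :: 'a \<times> 'a" 1] unfolding compact_def by metis
  obtain a b where ab: "y = (a, b)" by (cases y)
  define f where "f n = t (s n) *\<^sub>R u (s n)" for n
  define g where "g n = t (s n) *\<^sub>R v (s n)" for n
  have zs: "(z \<circ> s) n = (f n, g n)" for n by (simp add: z_def f_def g_def)
  have fa: "f \<longlonglongrightarrow> a" using tendsto_fst[OF y(3)] by (simp add: zs[unfolded o_def] o_def ab)
  have gb: "g \<longlonglongrightarrow> b" using tendsto_snd[OF y(3)] by (simp add: zs[unfolded o_def] o_def ab)
  have e_lim: "(\<lambda>n. e (s n)) \<longlonglongrightarrow> 0"
    using LIMSEQ_subseq_LIMSEQ[OF LIMSEQ_inverse_real_of_nat y(2)] by (simp add: o_def e_def)
  have "(\<lambda>n. p (s n) - w) \<longlonglongrightarrow> 0"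
    by (rule Lim_null_comparison[OF _ e_lim]) (simp add: pq)
  then have ps: "(\<lambda>n. p (s n)) \<longlonglongrightarrow> w" by (simp add: LIM_zero_iff)
  have "(\<lambda>n. q (s n) - w) \<longlonglongrightarrow> 0"
    by (rule Lim_null_comparison[OF _ e_lim]) (simp add: pq)
  then have qs: "(\<lambda>n. q (s n)) \<longlonglongrightarrow> w" by (simp add: LIM_zero_iff)
  have "(norm (f n + g n))\<^sup>2 \<le> e (s n)" for n
  proof -
    have "f n + g n = t (s n) *\<^sub>R (u (s n) + v (s n))" by (simp add: f_def g_def scaleR_add_right)
    then have "(norm (f n + g n))\<^sup>2 = (t (s n))\<^sup>2 * (norm (u (s n) + v (s n)))\<^sup>2"
      by (simp add: power_mult_distrib)
    also have "\<dots> \<le> (t (s n))\<^sup>2 * (e (s n) * ((norm (u (s n)))\<^sup>2 + (norm (v (s n)))\<^sup>2))"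
      using lt[of "s n"] by (intro mult_left_mono) auto
    also have "(norm (u (s n)))\<^sup>2 + (norm (v (s n)))\<^sup>2 = (norm (u (s n), v (s n)))\<^sup>2"
      by (simp add: norm_Pair)
    also have "(t (s n))\<^sup>2 * (e (s n) * (norm (u (s n), v (s n)))\<^sup>2) = e (s n)"
      using nz[of "s n"] by (simp add: t_def power_inverse)
    finally show ?thesis .
  qed
  then have "(\<lambda>n. (norm (f n + g n))\<^sup>2) \<longlonglongrightarrow> 0"
    by (intro Lim_null_comparison[OF _ e_lim]) simp
  moreover have "(\<lambda>n. (norm (f n + g n))\<^sup>2) \<longlonglongrightarrow> (norm (a + b))\<^sup>2"
    by (intro tendsto_intros fa gb)
  ultimately have "(norm (a + b))\<^sup>2 = 0" using LIMSEQ_unique by blast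
  then have ba: "a = - b" by (simp add: eq_neg_iff_add_eq_0)
  have "a \<in> limiting_normal_cone A w"
    by (rule limiting_normal_coneI[OF ps fa pq(3)])
      (auto simp: f_def intro: prox_normal_cone_scale uv(1) less_imp_le t0)
  moreover have "b \<in> limiting_normal_cone B w"
    by (rule limiting_normal_coneI[OF qs gb pq(4)])
      (auto simp: g_def intro: prox_normal_cone_scale uv(2) less_imp_le t0)
  moreover have "a \<in> V"
  proof (rule closed_sequentially[OF closed_subspace[OF V'(1)] _ fa])
    show "f n \<in> V" for n unfolding f_def using uv V'(1) subspace_scale by blast
  qed
  ultimately have "a = 0"
    using ahr ba unfolding affine_hull_regular_def V'(2) by blast
  then show False using y(1) ab ba by (simp add: zero_prod_def[symmetric])
qed

text \<open>Alternating projections started at the projection of \<open>x\<close> onto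
  \<open>B\<close> produce the witness: their limit is a point of \<open>A \<inter> B\<close>, and
  the length of their path is at most a multiple of the distance from the starting point to
  \<open>A\<close>, hence of \<open>infdist x A + infdist x B\<close>.\<close>

lemma affine_hull_regular_imp_linearly_regular_around:
  fixes A B :: "'a::euclidean_space set"
  assumes cl: "closed A" "closed B" and w: "w \<in> A \<inter> B"
    and sr: "superregular B w" and ahr: "affine_hull_regular A B w"
  shows "linearly_regular_around A B w"
proof -
  define L where "L = affine hull (A \<union> B)"
  define V where "V = mink_diff L L"
  have AL: "A \<subseteq> L" "B \<subseteq> L" by (auto simp: L_def hull_inc)
  obtain k0 \<delta>0 where k0: "0 < k0" "0 < \<delta>0"
    "\<And>p q u v. norm (p - w) \<le> \<delta>0 \<Longrightarrow> norm (q - w) \<le> \<delta>0 \<Longrightarrow> p \<in> A \<Longrightarrow> q \<in> B \<Longrightarrow>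
       u \<in> prox_normal_cone A p \<Longrightarrow> v \<in> prox_normal_cone B q \<Longrightarrow> u \<in> V \<Longrightarrow> v \<in> V \<Longrightarrow>
       k0 * ((norm u)\<^sup>2 + (norm v)\<^sup>2) \<le> (norm (u + v))\<^sup>2"
    using affine_hull_regular_angle[OF ahr w V_def[unfolded L_def]] by blast
  define k where "k = min k0 1"
  have k: "0 < k" "k \<le> 1" "k \<le> k0" using k0 by (auto simp: k_def)
  obtain \<delta>1 where d1: "0 < \<delta>1"
    "\<And>p c z. p \<in> proj B z \<Longrightarrow> norm (p - w) \<le> \<delta>1 \<Longrightarrow> c \<in> B \<Longrightarrow> norm (c - w) \<le> \<delta>1 \<Longrightarrow>
       (z - p) \<bullet> (p - c) \<ge> - (k / 4) * norm (z - p) * norm (p - c)"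
    using superregularD[OF sr, of "k / 4"] k by auto
  \<comment> \<open>The angle bound contributes the factor \<open>1 - k\<close>; superregularity
    with constant \<open>k / 4\<close>, applied to a displacement of length at most
    \<open>2 * norm u\<close>, adds \<open>k / 2\<close>. Capping \<open>k\<close> at 1 keeps the
    result nonnegative.\<close>
  define \<rho> where "\<rho> = 1 - k / 2"
  have \<rho>: "0 \<le> \<rho>" "\<rho> < 1" using k by (auto simp: \<rho>_def)
  define R where "R = min \<delta>0 \<delta>1 / 4"
  have R: "0 < R" "4 * R \<le> \<delta>0" "4 * R \<le> \<delta>1" using k0 d1 by (auto simp: R_def)
  \<comment> \<open>one step of alternating projections: the angle bound controls \<open>- (u \<bullet> v)\<close>, superregularity of \<open>B\<close>
    the rest of \<open>v \<bullet> v\<close>\<close>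
  have contract: "norm (a - b') \<le> \<rho> * norm (b - a)"
    if b: "b \<in> B" "norm (b - w) \<le> R" and a: "a \<in> proj A b" and b': "b' \<in> proj B a" for a b b'
  proof (cases "b - a = 0 \<or> a - b' = 0")
    case True
    have "norm (a - b') \<le> norm (b - a)"
      using projD(3)[OF b' b(1)] by (simp add: norm_minus_commute)
    then show ?thesis using True \<rho> by auto
  next
    case False
    define u where "u = b - a"
    define v where "v = a - b'"
    have uv0: "0 < norm u" "0 < norm v" using False by (auto simp: u_def v_def)
    have "norm u \<le> R" using projD(3)[OF a, of w] w b by (simp add: u_def)
    then have aw: "norm (a - w) \<le> 2 * R"
      using norm_triangle_ineq4[of "b - w" u] b by (simp add: u_def)
    have "norm v \<le> 2 * R" using projD(3)[OF b', of w] w aw by (simp add: v_def)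
    then have bw: "norm (b' - w) \<le> 4 * R"
      using norm_triangle_ineq4[of "a - w" v] aw by (simp add: v_def)
    have in_L: "a \<in> L" "b \<in> L" "b' \<in> L" using AL projD(1)[OF a] projD(1)[OF b'] b by auto
    then have inV: "u \<in> V" "v \<in> V" by (auto simp: u_def v_def V_def mink_diff_def)
    have sV: "subspace V"
      unfolding V_def using in_L by (auto simp: L_def intro: mink_diff_affine(1)[OF affine_affine_hull])
    \<comment> \<open>For unit vectors the angle bound reads
      \<open>2 * k0 \<le> 2 + 2 * (su \<bullet> sv)\<close>, which bounds the cosine of the angle
      between \<open>u\<close> and \<open>- v\<close> by \<open>1 - k0\<close>.\<close>
    define su where "su = inverse (norm u) *\<^sub>R u"
    define sv where "sv = inverse (norm v) *\<^sub>R v"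
    have "k0 * ((norm su)\<^sup>2 + (norm sv)\<^sup>2) \<le> (norm (su + sv))\<^sup>2"
    proof (rule k0(3)[of a b'])
      show "su \<in> prox_normal_cone A a" unfolding su_def u_def
        by (intro prox_normal_cone_scale prox_normal_coneI a) auto
      show "sv \<in> prox_normal_cone B b'" unfolding sv_def v_def
        by (intro prox_normal_cone_scale prox_normal_coneI b') auto
      show "su \<in> V" "sv \<in> V" unfolding su_def sv_def by (auto intro: subspace_scale[OF sV] inV)
    qed (use aw bw R projD(1)[OF a] projD(1)[OF b'] in auto)
    moreover have n1: "norm su = 1" "norm sv = 1" using uv0 by (auto simp: su_def sv_def)
    moreover have "(norm (su + sv))\<^sup>2 = (norm su)\<^sup>2 + (norm sv)\<^sup>2 + 2 * (su \<bullet> sv)"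
      by (simp add: power2_norm_eq_inner inner_add_left inner_add_right inner_commute)
    ultimately have "- (su \<bullet> sv) \<le> 1 - k" using k by simp
    then have "norm u * norm v * (- (su \<bullet> sv)) \<le> norm u * norm v * (1 - k)"
      using uv0 by (intro mult_left_mono) auto
    moreover have "u \<bullet> v = norm u * norm v * (su \<bullet> sv)" using uv0 by (simp add: su_def sv_def field_simps)
    ultimately have 1: "- (u \<bullet> v) \<le> norm u * norm v * (1 - k)" by simp
    have 2: "- (v \<bullet> (b' - b)) \<le> norm u * norm v * (k / 2)"
    proof -
      have "v \<bullet> (b' - b) \<ge> - (k / 4) * norm v * norm (b' - b)"
        unfolding v_def using b b' bw R by (intro d1(2)) auto
      moreover have "norm (b' - b) \<le> norm u + norm v"
        using norm_triangle_ineq[of u v] by (simp add: u_def v_def norm_minus_commute)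
      moreover have "norm v \<le> norm u"
        using projD(3)[OF b' b(1)] by (simp add: u_def v_def norm_minus_commute)
      ultimately have "norm (b' - b) \<le> 2 * norm u" by simp
      then have "(k / 4) * norm v * norm (b' - b) \<le> (k / 4) * norm v * (2 * norm u)"
        using k by (intro mult_left_mono) auto
      then show ?thesis
        using \<open>v \<bullet> (b' - b) \<ge> - (k / 4) * norm v * norm (b' - b)\<close> by (simp add: algebra_simps)
    qed
    have "v = - u + - (b' - b)" by (simp add: u_def v_def)
    then have "v \<bullet> v = v \<bullet> (- u + - (b' - b))" by (rule arg_cong)
    then have "v \<bullet> v = - (u \<bullet> v) + - (v \<bullet> (b' - b))"
      unfolding inner_add_right inner_minus_right inner_commute[of v u] .
    then have "norm v * norm v \<le> norm v * (\<rho> * norm u)"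
      using 1 2 by (simp add: \<rho>_def algebra_simps power2_norm_eq_inner[symmetric] power2_eq_square)
    then show ?thesis using uv0 by (simp add: u_def v_def)
  qed
  \<comment> \<open>A round trip from \<open>B\<close> to \<open>A\<close> and back moves
    \<open>b n\<close> by at most twice its distance to \<open>A\<close>; summing the geometric
    series gives \<open>K\<close>. The sequence starts within \<open>2 * R0\<close> of
    \<open>w\<close> and travels at most \<open>K * (2 * R0)\<close>, and \<open>R0\<close> makes
    these add up to \<open>R\<close>.\<close>
  define K where "K = 2 / (1 - \<rho>)"
  have K: "0 < K" using \<rho> by (simp add: K_def)
  define R0 where "R0 = R / (2 + 2 * K)"
  have "R0 * (2 + 2 * K) = R" using K by (simp add: R0_def)
  moreover have "R0 * (2 + 2 * K) = 2 * R0 + K * (2 * R0)" by (simp add: algebra_simps)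
  ultimately have R0: "2 * R0 + K * (2 * R0) = R" "0 < R0" using R K by (simp_all add: R0_def)
  have ne: "A \<noteq> {}" "B \<noteq> {}" using w by auto
  define pa where "pa x = (SOME a. a \<in> proj A x)" for x
  define pb where "pb x = (SOME b. b \<in> proj B x)" for x
  have pa: "pa x \<in> proj A x" for x
    unfolding pa_def using proj_nonempty[OF cl(1) ne(1), of x] by (rule someI_ex) blast
  have pb: "pb x \<in> proj B x" for x
    unfolding pb_def using proj_nonempty[OF cl(2) ne(2), of x] by (rule someI_ex) blast
  have "infdist x (A \<inter> B) \<le> (1 + 2 * K) * max (infdist x A) (infdist x B)" if x: "norm (x - w) \<le> R0" for x
  proof -
    define b where "b n = ((pb \<circ> pa) ^^ n) (pb x)" for n
    have b0: "b 0 = pb x" and bS: "b (Suc n) = pb (pa (b n))" for n by (auto simp: b_def)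
    have bB: "b n \<in> B" for n using projD(1)[OF pb] b0 bS by (cases n) auto
    have xb: "norm (x - b 0) = infdist x B" using projD(2)[OF pb] b0 by simp
    have "norm (x - b 0) \<le> R0" using projD(3)[OF pb, of w x] w x b0 by simp
    then have b0w: "norm (b 0 - w) \<le> 2 * R0"
      using norm_triangle_ineq4[of "x - w" "x - b 0"] x by simp
    have g0: "infdist (b 0) A \<le> 2 * R0"
      using infdist_le[of w A "b 0"] w b0w by (simp add: dist_norm)
    have step: "infdist (b (Suc n)) A \<le> \<rho> * infdist (b n) A \<and>
        norm (b (Suc n) - b n) \<le> 2 * infdist (b n) A" if "norm (b n - w) \<le> R" for n
    proof -
      have ga: "norm (b n - pa (b n)) = infdist (b n) A" using projD(2)[OF pa] .
      have c: "norm (pa (b n) - b (Suc n)) \<le> \<rho> * infdist (b n) A"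
        using contract[OF bB that pa pb] ga bS by simp
      also have "\<dots> \<le> 1 * infdist (b n) A" using \<rho> by (intro mult_right_mono infdist_nonneg) auto
      finally have "norm (b (Suc n) - b n) \<le> 2 * infdist (b n) A"
        using norm_triangle_ineq[of "b n - pa (b n)" "pa (b n) - b (Suc n)"] ga
        by (simp add: norm_minus_commute)
      moreover have "infdist (b (Suc n)) A \<le> norm (pa (b n) - b (Suc n))"
        using infdist_le[OF projD(1)[OF pa], of "b (Suc n)" "b n"] by (simp add: dist_norm norm_minus_commute)
      ultimately show ?thesis using c by simp
    qed
    have "norm (b 0 - w) + 2 / (1 - \<rho>) * infdist (b 0) A \<le> R"
      using b0w mult_left_mono[OF g0, of K] K R0(1) unfolding K_def by linarith
    then obtain y where y: "\<And>n. norm (b n - y) \<le> 2 / (1 - \<rho>) * infdist (b 0) A * \<rho> ^ n"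
      "\<And>n. infdist (b n) A \<le> \<rho> ^ n * infdist (b 0) A"
      using merit_decrease_converges[OF \<rho>, of 2 "\<lambda>n. infdist (b n) A" b w R] step infdist_nonneg[of "b 0" A]
      by auto
    have "R_linear_conv b y" unfolding R_linear_conv_def
      using \<rho> y(1) infdist_nonneg[of "b 0" A]
      by (intro exI[of _ \<rho>] exI[of _ "2 / (1 - \<rho>) * infdist (b 0) A"]) auto
    then have lim: "b \<longlonglongrightarrow> y" by (rule R_linear_conv_tendsto)
    have "y \<in> A" using limit_mem_of_infdist_decay[OF cl(1) ne(1) lim \<rho> y(2)] .
    moreover have "y \<in> B" using closed_sequentially[OF cl(2) _ lim] bB by blast
    ultimately have "infdist x (A \<inter> B) \<le> norm (x - y)"
      using infdist_le[of y "A \<inter> B" x] by (simp add: dist_norm)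
    also have "\<dots> \<le> norm (x - b 0) + norm (b 0 - y)"
      using norm_triangle_ineq[of "x - b 0" "b 0 - y"] by simp
    also have "\<dots> \<le> infdist x B + K * infdist (b 0) A"
      using y(1)[of 0] xb by (simp add: K_def)
    also have "infdist (b 0) A \<le> infdist x A + infdist x B"
      using infdist_triangle[of "b 0" A x] xb by (simp add: dist_norm norm_minus_commute)
    then have "infdist x B + K * infdist (b 0) A \<le> infdist x B + K * (infdist x A + infdist x B)"
      using K by simp
    also have "\<dots> \<le> max (infdist x A) (infdist x B) + K * (2 * max (infdist x A) (infdist x B))"
      using K by (intro add_mono mult_left_mono) auto
    finally show ?thesis by (simp add: algebra_simps)
  qed
  then show ?thesis
    unfolding linearly_regular_around_def linearly_regular_on_def
    using R0(2) K by (intro exI[of _ R0] conjI exI[of _ "1 + 2 * K"])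
      (auto simp: dist_norm norm_minus_commute)
qed

text \<open>For \<open>x\<close> in the affine hull the reflected point stays in the hull, being an
  affine combination of \<open>x\<close> and \<open>p\<close>. Both residuals are then parallel to
  the hull, where the angle bound controls them by their sum, which is all that the gain sees
  here.\<close>

lemma gain_coercive_near_reflections:
  fixes A B :: "'a::euclidean_space set"
  assumes ahr: "affine_hull_regular A B w" and w: "w \<in> A \<inter> B" and "\<alpha> < 1"
  shows "gain_coercive_near A B 2 2 \<alpha> w (affine hull (A \<union> B))"
proof -
  define L where "L = affine hull (A \<union> B)"
  define V where "V = mink_diff L L"
  have AL: "A \<subseteq> L" "B \<subseteq> L" "affine L" by (auto simp: L_def hull_inc)
  obtain k \<delta> where k: "0 < k" "0 < \<delta>"
    "\<And>p q u v. norm (p - w) \<le> \<delta> \<Longrightarrow> norm (q - w) \<le> \<delta> \<Longrightarrow> p \<in> A \<Longrightarrow> q \<in> B \<Longrightarrow>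
       u \<in> prox_normal_cone A p \<Longrightarrow> v \<in> prox_normal_cone B q \<Longrightarrow> u \<in> V \<Longrightarrow> v \<in> V \<Longrightarrow>
       k * ((norm u)\<^sup>2 + (norm v)\<^sup>2) \<le> (norm (u + v))\<^sup>2"
    using affine_hull_regular_angle[OF ahr w V_def[unfolded L_def]] by blast
  have "4 * (1 - \<alpha>) * k * ((norm (x - p))\<^sup>2 + (norm (x - 2 *\<^sub>R (x - p) - q))\<^sup>2)
      \<le> gain 2 2 \<alpha> (x - p) (x - 2 *\<^sub>R (x - p) - q)"
    if x: "x \<in> L" "norm (x - w) \<le> \<delta> / 6" and p: "p \<in> proj A x" and q: "q \<in> proj B (x - 2 *\<^sub>R (x - p))" for x p q
  proof -
    define r where "r = x - 2 *\<^sub>R (x - p)"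
    have "norm (x - p) \<le> \<delta> / 6" using projD(3)[OF p, of w] w x by simp
    then have pw: "norm (p - w) \<le> \<delta> / 3"
      using norm_triangle_ineq4[of "x - w" "x - p"] x by simp
    have rw: "norm (r - w) \<le> \<delta> / 2"
      using norm_triangle_ineq4[of "p - w" "x - p"] pw \<open>norm (x - p) \<le> \<delta> / 6\<close>
      by (simp add: r_def algebra_simps scaleR_2)
    have "norm (r - q) \<le> \<delta> / 2" using projD(3)[OF q, of w] w rw by (simp add: r_def)
    then have qw: "norm (q - w) \<le> \<delta>"
      using norm_triangle_ineq4[of "r - w" "r - q"] rw by simp
    have pL: "p \<in> L" "q \<in> L" using projD(1)[OF p] projD(1)[OF q] AL by auto
    have "r = (1 - 2) *\<^sub>R x + 2 *\<^sub>R p" by (simp add: r_def algebra_simps scaleR_2)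
    then have "r \<in> L" using AL(3) x(1) pL unfolding affine_alt by metis
    then have "x - p \<in> V" "r - q \<in> V" using x pL by (auto simp: V_def mink_diff_def)
    then have "k * ((norm (x - p))\<^sup>2 + (norm (r - q))\<^sup>2) \<le> (norm (x - p + (r - q)))\<^sup>2"
      using pw qw k(2) projD(1)[OF p] projD(1)[OF q] prox_normal_coneI[OF p] prox_normal_coneI[OF q]
      by (intro k(3)[of p q]) (auto simp: r_def)
    then have "4 * (1 - \<alpha>) * (k * ((norm (x - p))\<^sup>2 + (norm (r - q))\<^sup>2))
        \<le> 4 * (1 - \<alpha>) * (norm (x - p + (r - q)))\<^sup>2"
      using \<open>\<alpha> < 1\<close> by (intro mult_left_mono) auto
    then show ?thesis unfolding gain_reflections r_def by (simp only: mult.assoc)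
  qed
  then show ?thesis
    unfolding gain_coercive_near_def L_def[symmetric] using k \<open>\<alpha> < 1\<close>
    by (intro exI[of _ "4 * (1 - \<alpha>) * k"] conjI exI[of _ "\<delta> / 6"])
      (auto simp: dist_norm norm_minus_commute)
qed

section \<open>Displacements orthogonal to the affine hull\<close>

lemma inner_orthogonal_comp_mink_diff:
  assumes "z \<in> orthogonal_comp (mink_diff L L)" "x \<in> L" "y \<in> L"
  shows "(x - y) \<bullet> z = 0"
  using assms unfolding orthogonal_comp_def orthogonal_def mink_diff_def by blast

text \<open>By Pythagoras the displacement \<open>z\<close> adds the same constant to all squared
  distances from \<open>y\<close> to points of \<open>S\<close>.\<close>

lemma proj_add_orthogonal:
  assumes "S \<subseteq> L" "y \<in> L" and z: "z \<in> orthogonal_comp (mink_diff L L)"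
  shows "proj S (y + z) = proj S y"
proof (cases "S = {}")
  case False
  have "(norm (y + z - a))\<^sup>2 = (norm (y - a))\<^sup>2 + (norm z)\<^sup>2" if "a \<in> S" for a
  proof -
    have "(norm (y - a + z))\<^sup>2 = (norm (y - a))\<^sup>2 + (norm z)\<^sup>2"
      using inner_orthogonal_comp_mink_diff[OF z \<open>y \<in> L\<close>, of a] that assms(1)
      by (auto simp: power2_norm_eq_inner inner_add_left inner_add_right inner_commute)
    then show ?thesis by (simp add: algebra_simps)
  qed
  then have "norm (y + z - c) \<le> norm (y + z - a) \<longleftrightarrow> norm (y - c) \<le> norm (y - a)"
    if "a \<in> S" "c \<in> S" for a c
    using that by (metis add_le_cancel_right norm_ge_zero power2_le_imp_le power_mono)
  then show ?thesis using proj_iff[OF False] by blast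
qed (simp add: proj_def)

text \<open>For \<open>l = m = 2\<close> the step is a multiple of \<open>p - q\<close>, hence leaves the component of \<open>x\<close>
  orthogonal to \<open>L - L\<close> unchanged.\<close>

lemma alg_op_reflections_shift:
  fixes A B :: "'a::euclidean_space set"
  assumes L: "affine L" "A \<subseteq> L" "B \<subseteq> L" and y: "y \<in> L"
    and z: "z \<in> orthogonal_comp (mink_diff L L)"
    and x': "x' \<in> alg_op A B 2 2 \<alpha> (y + z)"
  shows "x' - z \<in> alg_op A B 2 2 \<alpha> y \<and> x' - z \<in> L"
proof -
  obtain p q where p: "p \<in> proj A (y + z)" and q: "q \<in> proj B (y + z - 2 *\<^sub>R (y + z - p))"
    and x': "x' = y + z - \<alpha> *\<^sub>R (2 *\<^sub>R (y + z - p) + 2 *\<^sub>R (y + z - 2 *\<^sub>R (y + z - p) - q))"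
    using x' unfolding alg_op_iff by blast
  have pA: "p \<in> proj A y" using p proj_add_orthogonal[OF L(2) y z] by simp
  have pq: "p \<in> L" "q \<in> L" using projD(1)[OF p] projD(1)[OF q] L by auto
  have "y - 2 *\<^sub>R (y - p) = (1 - 2) *\<^sub>R y + 2 *\<^sub>R p" by (simp add: algebra_simps scaleR_2)
  then have rL: "y - 2 *\<^sub>R (y - p) \<in> L" using L(1) y pq unfolding affine_alt by metis
  \<comment> \<open>The first reflection turns the orthogonal component \<open>z\<close> into
    \<open>- z\<close>, so the projection onto \<open>B\<close> has to be compared with a shift by
    \<open>- z\<close>.\<close>
  have "- z \<in> orthogonal_comp (mink_diff L L)"
    using z subspace_orthogonal_comp subspace_neg by blast
  moreover have "y + z - 2 *\<^sub>R (y + z - p) = (y - 2 *\<^sub>R (y - p)) + (- z)"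
    by (simp add: algebra_simps scaleR_2)
  ultimately have qB: "q \<in> proj B (y - 2 *\<^sub>R (y - p))"
    using q proj_add_orthogonal[OF L(3) rL] by metis
  have x'z: "x' - z = y - \<alpha> *\<^sub>R (2 *\<^sub>R (y - p) + 2 *\<^sub>R (y - 2 *\<^sub>R (y - p) - q))"
    by (simp add: x' algebra_simps scaleR_2)
  then have "x' - z \<in> alg_op A B 2 2 \<alpha> y" unfolding alg_op_iff using pA qB by blast
  moreover have "x' - z \<in> L"
  proof -
    have "x' - z = y + (2 * \<alpha>) *\<^sub>R (q - p)"
      unfolding x'z by (simp add: algebra_simps scaleR_2 flip: scaleR_scaleR)
    then show ?thesis using mem_affine_3_minus[OF L(1) y pq(2) pq(1)] by simp
  qed
  ultimately show ?thesis by blast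
qed

lemma alg_op_reflections_shift_sequence:
  fixes A B :: "'a::euclidean_space set"
  assumes L: "affine L" "A \<subseteq> L" "B \<subseteq> L" and y: "x 0 - z \<in> L"
    and z: "z \<in> orthogonal_comp (mink_diff L L)"
    and x: "\<And>n. x (Suc n) \<in> alg_op A B 2 2 \<alpha> (x n)"
  shows "x n - z \<in> L" "x (Suc n) - z \<in> alg_op A B 2 2 \<alpha> (x n - z)"
proof -
  have *: "x (Suc n) - z \<in> alg_op A B 2 2 \<alpha> (x n - z) \<and> x (Suc n) - z \<in> L" if "x n - z \<in> L" for n
    using alg_op_reflections_shift[OF L that z] x[of n] by simp
  show L': "x n - z \<in> L" for n by (induction n) (use y * in auto)
  show "x (Suc n) - z \<in> alg_op A B 2 2 \<alpha> (x n - z)" using * L' by blast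
qed

text \<open>The norm estimate ensures that translating a start near \<open>w\<close> into
  \<open>L\<close> does not push it out of the ball about \<open>w\<close>.\<close>

lemma affine_orthogonal_decomp:
  fixes L :: "'a::euclidean_space set"
  assumes "affine L" "w \<in> L"
  obtains z where "z \<in> orthogonal_comp (mink_diff L L)" "x - z \<in> L" "norm (x - z - w) \<le> norm (x - w)"
proof -
  note V = mink_diff_affine[OF assms]
  obtain y z where yz: "y \<in> span (mink_diff L L)" "\<And>v. v \<in> span (mink_diff L L) \<Longrightarrow> orthogonal z v"
    "x - w = y + z"
    using orthogonal_subspace_decomp_exists[of "mink_diff L L" "x - w"] by metis
  have y: "y \<in> mink_diff L L" using yz(1) V(1) span_eq_iff by blast
  have "y \<in> mink_diff L {w}" using y V(2) by simp
  then have "w + y \<in> L" by (auto simp: mink_diff_def)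
  moreover have xz: "x - z = w + y" using yz(3) by (simp add: algebra_simps)
  moreover have "norm y \<le> norm (x - w)"
  proof -
    have "orthogonal y z" using yz(1,2) orthogonal_commute by blast
    then have "(norm (x - w))\<^sup>2 = (norm y)\<^sup>2 + (norm z)\<^sup>2" unfolding yz(3) by (rule norm_add_Pythagorean)
    then have "(norm y)\<^sup>2 \<le> (norm (x - w))\<^sup>2" by simp
    then show ?thesis by (rule power2_le_imp_le) simp
  qed
  moreover have "z \<in> orthogonal_comp (mink_diff L L)"
    using yz(2) by (auto simp: orthogonal_comp_def orthogonal_commute span_base)
  ultimately show thesis using that by auto
qed

lemma orthogonal_comp_subset_limiting_normal_cone:
  assumes "S \<subseteq> L" "w \<in> S" and z: "z \<in> orthogonal_comp (mink_diff L L)"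
  shows "z \<in> limiting_normal_cone S w"
proof -
  have "w \<in> proj S (w + z)"
    using proj_add_orthogonal[of S L w z] assms proj_self[of w S] by auto
  then have "z \<in> prox_normal_cone S w" using prox_normal_coneI by force
  then show ?thesis using assms(2) limiting_normal_coneI[OF tendsto_const tendsto_const] by blast
qed

section \<open>The two parameter regimes and the local theorems\<close>

lemma admissible_cases:
  assumes "admissible l m \<alpha>"
  obtains "min l m < 2" | "l = 2" "m = 2" "\<alpha> < 1" "0 < \<alpha>"
proof (cases "min l m < 2")
  case False
  then have "l = 2" "m = 2" using assms by (auto simp: admissible_def)
  then show thesis using that(2) assms by (simp add: admissible_def beta_hat_def)
qed (rule that(1))

lemma locally_converges_linearly_regular:
  fixes A B :: "'a::euclidean_space set"
  assumes "closed A" "closed B" "w \<in> A \<inter> B" "admissible l m \<alpha>" "min l m < 2"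
    and "superregular A w" "superregular B w" "linearly_regular_around A B w"
  shows "locally_converges (alg_op A B l m \<alpha>) w (\<lambda>y. y \<in> A \<inter> B)"
proof -
  obtain r where r: "0 < r"
    "\<And>x. norm (x 0 - w) \<le> r \<Longrightarrow> (\<And>n. x n \<in> UNIV) \<Longrightarrow> (\<And>n. x (Suc n) \<in> alg_op A B l m \<alpha> (x n)) \<Longrightarrow>
       \<exists>y \<in> A \<inter> B. R_linear_conv x y"
    using superregular_local_convergence[OF assms(1-4,6-8) gain_coercive_near_UNIV[OF assms(4,5)]] by metis
  show ?thesis
    unfolding locally_converges_def
  proof (intro exI[of _ r] conjI allI impI)
    fix x assume "x 0 \<in> cball w r" "\<forall>n. x (Suc n) \<in> alg_op A B l m \<alpha> (x n)"
    then show "\<exists>xbar. R_linear_conv x xbar \<and> xbar \<in> A \<inter> B"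
      using r(2)[of x] by (auto simp: dist_norm norm_minus_commute)
  qed (rule r(1))
qed

lemma R_linear_conv_add_const:
  assumes "R_linear_conv (\<lambda>n. x n - z) y" shows "R_linear_conv x (y + z)"
  using assms by (simp add: R_linear_conv_def algebra_simps)

text \<open>The radius restricts the translated start \<open>x 0 - z\<close> and leaves
  \<open>z\<close> free. Thus the result also serves the global convex case, where the orthogonal
  part of the start is arbitrarily large.\<close>

lemma reflections_local_convergence:
  fixes A B :: "'a::euclidean_space set"
  assumes cl: "closed A" "closed B" and w: "w \<in> A \<inter> B" and \<alpha>: "0 < \<alpha>" "\<alpha> < 1"
    and sr: "superregular A w" "superregular B w" and ahr: "affine_hull_regular A B w"
    and L: "L = affine hull (A \<union> B)"
  obtains r where "0 < r"
    "\<And>x z. z \<in> orthogonal_comp (mink_diff L L) \<Longrightarrow> x 0 - z \<in> L \<Longrightarrow> norm (x 0 - z - w) \<le> r \<Longrightarrow>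
       (\<And>n. x (Suc n) \<in> alg_op A B 2 2 \<alpha> (x n)) \<Longrightarrow> \<exists>y \<in> A \<inter> B. R_linear_conv x (y + z)"
proof -
  have AL: "affine L" "A \<subseteq> L" "B \<subseteq> L" by (auto simp: L hull_inc)
  have adm: "admissible 2 2 \<alpha>" using \<alpha> by (simp add: admissible_def beta_hat_def)
  obtain r where r: "0 < r"
    "\<And>x. norm (x 0 - w) \<le> r \<Longrightarrow> (\<And>n. x n \<in> L) \<Longrightarrow> (\<And>n. x (Suc n) \<in> alg_op A B 2 2 \<alpha> (x n)) \<Longrightarrow>
       \<exists>y \<in> A \<inter> B. R_linear_conv x y"
    using superregular_local_convergence[OF cl w adm sr
        affine_hull_regular_imp_linearly_regular_around[OF cl w sr(2) ahr]
        gain_coercive_near_reflections[OF ahr w \<alpha>(2)]] L by metis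
  show thesis
  proof (rule that[OF r(1)])
    fix x z assume z: "z \<in> orthogonal_comp (mink_diff L L)" and x: "x 0 - z \<in> L" "norm (x 0 - z - w) \<le> r"
       "\<And>n. x (Suc n) \<in> alg_op A B 2 2 \<alpha> (x n)"
    note sh = alg_op_reflections_shift_sequence[of L A B x z, OF AL x(1) z x(3)]
    show "\<exists>y \<in> A \<inter> B. R_linear_conv x (y + z)"
      using r(2)[of "\<lambda>n. x n - z"] x(2) sh R_linear_conv_add_const by blast
  qed
qed

lemma shifted_common_point:
  fixes A B :: "'a::euclidean_space set"
  assumes "A \<subseteq> L" "B \<subseteq> L" and y: "y \<in> A \<inter> B" and z: "z \<in> orthogonal_comp (mink_diff L L)"
  shows "y + z \<in> (A \<inter> B) + orthogonal_comp (mink_diff L L)"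
    and "\<exists>p \<in> A \<inter> B. proj A (y + z) = {p} \<and> proj B (y + z) = {p}"
proof -
  show "y + z \<in> (A \<inter> B) + orthogonal_comp (mink_diff L L)" using y z by (rule set_plus_intro)
  have "proj A (y + z) = {y}" "proj B (y + z) = {y}"
    using proj_add_orthogonal[OF assms(1) _ z, of y] proj_add_orthogonal[OF assms(2) _ z, of y]
      proj_self[of y] y assms(1) by auto
  then show "\<exists>p \<in> A \<inter> B. proj A (y + z) = {p} \<and> proj B (y + z) = {p}" using y by blast
qed

text \<open>\<open>w\<close> is the projection of both \<open>w + z\<close> and \<open>w - z\<close>
  onto each set, so \<open>z\<close> is normal to \<open>A\<close> and \<open>- z\<close> is normal
  to \<open>B\<close>.\<close>

lemma strongly_regular_orthogonal_comp:
  fixes A B :: "'a::euclidean_space set"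
  assumes "strongly_regular A B w" "w \<in> A \<inter> B" "A \<subseteq> L" "B \<subseteq> L"
    and z: "z \<in> orthogonal_comp (mink_diff L L)"
  shows "z = 0"
proof -
  have "- z \<in> orthogonal_comp (mink_diff L L)"
    using z subspace_orthogonal_comp subspace_neg by blast
  then have "z \<in> limiting_normal_cone A w" "- z \<in> limiting_normal_cone B w"
    using orthogonal_comp_subset_limiting_normal_cone assms by (metis IntD1, metis IntD2)
  then have "z \<in> limiting_normal_cone A w \<inter> uminus ` limiting_normal_cone B w" by force
  then show ?thesis using assms(1) unfolding strongly_regular_def by blast
qed

lemma zero_mem_orthogonal_comp: "0 \<in> orthogonal_comp W"
  by (simp add: orthogonal_comp_def orthogonal_def)

lemma locally_converges_affine_hull_regular:
  fixes A B :: "'a::euclidean_space set"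
  assumes cl: "closed A" "closed B" and w: "w \<in> A \<inter> B" and adm: "admissible l m \<alpha>"
    and sr: "superregular A w" "superregular B w" and ahr: "affine_hull_regular A B w"
    and L: "L = affine hull (A \<union> B)"
  shows "locally_converges (alg_op A B l m \<alpha>) w (\<lambda>xbar.
          xbar \<in> (A \<inter> B) + orthogonal_comp (mink_diff L L) \<and>
          (\<exists>p \<in> A \<inter> B. proj A xbar = {p} \<and> proj B xbar = {p}) \<and>
          (strongly_regular A B w \<longrightarrow> xbar \<in> A \<inter> B))"
  using adm
proof (cases rule: admissible_cases)
  case 1
  have AL: "A \<subseteq> L" "B \<subseteq> L" by (auto simp: L hull_inc)
  have "locally_converges (alg_op A B l m \<alpha>) w (\<lambda>y. y \<in> A \<inter> B)"
    using locally_converges_linearly_regular[OF cl w adm 1 sr]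
      affine_hull_regular_imp_linearly_regular_around[OF cl w sr(2) ahr] .
  \<comment> \<open>A limit in \<open>A \<inter> B\<close> is covered by
    \<open>shifted_common_point\<close> with shift 0.\<close>
  then show ?thesis
    unfolding locally_converges_def
    using shifted_common_point[OF AL _ zero_mem_orthogonal_comp] by (metis add.right_neutral)
next
  case 2
  have AL: "affine L" "A \<subseteq> L" "B \<subseteq> L" by (auto simp: L hull_inc)
  have wL: "w \<in> L" using AL w by auto
  obtain r where r: "0 < r"
    "\<And>x z. z \<in> orthogonal_comp (mink_diff L L) \<Longrightarrow> x 0 - z \<in> L \<Longrightarrow> norm (x 0 - z - w) \<le> r \<Longrightarrow>
       (\<And>n. x (Suc n) \<in> alg_op A B 2 2 \<alpha> (x n)) \<Longrightarrow> \<exists>y \<in> A \<inter> B. R_linear_conv x (y + z)"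
    using reflections_local_convergence[OF cl w 2(4,3) sr ahr L] by metis
  show ?thesis
    unfolding locally_converges_def
  proof (intro exI[of _ r] conjI allI impI)
    fix x assume x: "x 0 \<in> cball w r" "\<forall>n. x (Suc n) \<in> alg_op A B l m \<alpha> (x n)"
    obtain z where z: "z \<in> orthogonal_comp (mink_diff L L)" "x 0 - z \<in> L"
      "norm (x 0 - z - w) \<le> norm (x 0 - w)"
      using affine_orthogonal_decomp[OF AL(1) wL] by metis
    obtain y where y: "y \<in> A \<inter> B" "R_linear_conv x (y + z)"
      using r(2)[of z x] z x 2 by (auto simp: dist_norm norm_minus_commute)
    moreover have "strongly_regular A B w \<longrightarrow> z = 0"
      using strongly_regular_orthogonal_comp[OF _ w AL(2,3) z(1)] by blast
    ultimately show "\<exists>xbar. R_linear_conv x xbar \<and>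
          xbar \<in> (A \<inter> B) + orthogonal_comp (mink_diff L L) \<and>
          (\<exists>p \<in> A \<inter> B. proj A xbar = {p} \<and> proj B xbar = {p}) \<and>
          (strongly_regular A B w \<longrightarrow> xbar \<in> A \<inter> B)"
      using shifted_common_point[OF AL(2,3) y(1) z(1)] by (intro exI[of _ "y + z"]) auto
  qed (rule r(1))
qed

section \<open>Convex sets\<close>

lemma proj_convex:
  assumes "convex S" "closed S" "S \<noteq> {}"
  shows "proj S x = {closest_point S x}"
proof (rule set_eqI)
  fix p
  show "p \<in> proj S x \<longleftrightarrow> p \<in> {closest_point S x}"
  proof
    assume "p \<in> proj S x"
    then have "p \<in> S" "\<forall>a\<in>S. dist x p \<le> dist x a" using projD by (auto simp: dist_norm)
    then show "p \<in> {closest_point S x}" using closest_point_unique[OF assms(1,2)] by simp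
  next
    assume "p \<in> {closest_point S x}"
    then show "p \<in> proj S x"
      using closest_point_exists[OF assms(2,3), of x] proj_iff[OF assms(3)] by (simp add: dist_norm)
  qed
qed

lemma proj_convex_inner_le:
  assumes "convex S" "p \<in> proj S x" "a \<in> S"
  shows "(x - p) \<bullet> (a - p) \<le> 0"
proof (rule ccontr)
  assume "\<not> (x - p) \<bullet> (a - p) \<le> 0"
  then obtain u where u: "0 < u" "u \<le> 1" "dist (p + u *\<^sub>R (a - p)) x < dist p x"
    using closer_point_lemma[of x p a] by auto
  have "p + u *\<^sub>R (a - p) \<in> S"
    using convexD_alt[OF assms(1) projD(1)[OF assms(2)] assms(3), of u] u
    by (simp add: algebra_simps)
  then show False using projD(3)[OF assms(2)] u(3) by (force simp: dist_norm norm_minus_commute)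
qed

lemma prox_normal_cone_convex:
  assumes "convex S" "u \<in> prox_normal_cone S x" "a \<in> S"
  shows "u \<bullet> (a - x) \<le> 0"
proof -
  obtain t z where "u = t *\<^sub>R (z - x)" "x \<in> proj S z" "0 \<le> t"
    using assms(2) by (auto simp: prox_normal_cone_def)
  then show ?thesis
    using proj_convex_inner_le[OF assms(1) _ assms(3)] by (simp add: mult_nonneg_nonpos)
qed

lemma limiting_normal_cone_convex:
  assumes "convex S" "u \<in> limiting_normal_cone S x" "a \<in> S"
  shows "u \<bullet> (a - x) \<le> 0"
proof -
  obtain xs us where xs: "xs \<longlonglongrightarrow> x" "us \<longlonglongrightarrow> u" "\<And>n. us n \<in> prox_normal_cone S (xs n)"
    using assms(2) by (auto simp: limiting_normal_cone_def)
  have "(\<lambda>n. us n \<bullet> (a - xs n)) \<longlonglongrightarrow> u \<bullet> (a - x)" by (intro tendsto_intros xs)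
  then show ?thesis
    using prox_normal_cone_convex[OF assms(1) xs(3) assms(3)] by (intro LIMSEQ_le_const2) auto
qed

lemma convex_imp_superregular:
  assumes "convex S" shows "superregular S w"
  unfolding superregular_def
proof (intro allI impI exI[of _ 1] conjI ballI)
  fix \<epsilon> :: real and x y u
  assume "0 < \<epsilon>" "x \<in> S \<inter> cball w 1" "y \<in> S \<inter> cball w 1" "u \<in> prox_normal_cone S x"
  then have "u \<bullet> (y - x) \<le> 0" "0 \<le> \<epsilon> * norm u * norm (x - y)"
    using prox_normal_cone_convex[OF assms] by auto
  then show "- \<epsilon> * norm u * norm (x - y) \<le> u \<bullet> (x - y)" by (simp add: inner_diff_right)
qed simp

text \<open>A segment from \<open>a\<close> to the relative interior point \<open>c\<close> can be
  prolonged beyond \<open>c\<close> within \<open>S\<close>; a value at \<open>a\<close> below the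
  maximum at \<open>c\<close> would be exceeded on the prolongation.\<close>

lemma rel_interior_inner_max_const:
  fixes u c :: "'a::euclidean_space"
  assumes "convex S" "c \<in> rel_interior S" "\<And>a. a \<in> S \<Longrightarrow> u \<bullet> a \<le> u \<bullet> c" "a \<in> S"
  shows "u \<bullet> a = u \<bullet> c"
proof -
  obtain e where e: "e > 1" "(1 - e) *\<^sub>R a + e *\<^sub>R c \<in> S"
    using convex_rel_interior_if2[OF assms(1,2)] assms(4) by (meson hull_inc)
  have "u \<bullet> ((1 - e) *\<^sub>R a + e *\<^sub>R c) \<le> u \<bullet> c" using assms(3) e(2) .
  then have "(1 - e) * (u \<bullet> a - u \<bullet> c) \<le> 0" by (simp add: inner_add_right algebra_simps)
  then have "u \<bullet> c \<le> u \<bullet> a" using e(1) by (simp add: mult_le_0_iff)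
  then show ?thesis using assms(3,4) by (simp add: antisym)
qed

text \<open>\<open>u\<close> is maximal over \<open>A\<close> and minimal over \<open>B\<close> at
  \<open>p\<close>, hence also at the common point \<open>c\<close>, which is relatively interior to
  both. So \<open>u\<close> is constant on \<open>A \<union> B\<close> and on \<open>L\<close>, that
  is, orthogonal to \<open>L - L\<close>, to which it belongs. Stated by inequalities, this applies
  both to limiting normals and to the residual at a fixed point.\<close>

lemma rel_interior_normals_trivial:
  fixes A B :: "'a::euclidean_space set"
  assumes cv: "convex A" "convex B" and ri: "c \<in> rel_interior A \<inter> rel_interior B" and p: "p \<in> A \<inter> B"
    and nA: "\<And>a. a \<in> A \<Longrightarrow> u \<bullet> (a - p) \<le> 0" and nB: "\<And>b. b \<in> B \<Longrightarrow> u \<bullet> (b - p) \<ge> 0"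
    and u: "u \<in> mink_diff L L" and L: "L = affine hull (A \<union> B)"
  shows "u = 0"
proof -
  have c: "c \<in> A" "c \<in> B" using ri rel_interior_subset by blast+
  have uc: "u \<bullet> c = u \<bullet> p" using nA[OF c(1)] nB[OF c(2)] by (simp add: inner_diff_right)
  have "u \<bullet> a = u \<bullet> c" if "a \<in> A" for a
    using rel_interior_inner_max_const[OF cv(1), of c u a] ri nA that uc by (auto simp: inner_diff_right)
  moreover have "(- u) \<bullet> b = (- u) \<bullet> c" if "b \<in> B" for b
    using rel_interior_inner_max_const[OF cv(2), of c "- u" b] ri nB that uc by (auto simp: inner_diff_right)
  ultimately have "A \<union> B \<subseteq> {x. u \<bullet> x = u \<bullet> p}" using uc by auto
  then have "L \<subseteq> {x. u \<bullet> x = u \<bullet> p}" unfolding L by (intro hull_minimal affine_hyperplane)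
  then have const: "u \<bullet> x = u \<bullet> p" if "x \<in> L" for x using that by blast
  have "u \<bullet> (s - r) = 0" if "s \<in> L" "r \<in> L" for s r
    using const[OF that(1)] const[OF that(2)] by (simp add: inner_diff_right)
  then have "u \<bullet> u = 0" using u unfolding mink_diff_def by blast
  then show ?thesis by simp
qed

lemma rel_interior_imp_affine_hull_regular:
  fixes A B :: "'a::euclidean_space set"
  assumes cv: "convex A" "convex B" and ri: "c \<in> rel_interior A \<inter> rel_interior B" and p: "p \<in> A \<inter> B"
  shows "affine_hull_regular A B p"
proof -
  define L where "L = affine hull (A \<union> B)"
  have "p \<in> L" using p by (simp add: L_def hull_inc)
  then have V: "mink_diff L {p} = mink_diff L L" "subspace (mink_diff L L)"
    using mink_diff_affine[of L p] by (auto simp: L_def)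
  have "u = 0" if "u \<in> limiting_normal_cone A p" "- u \<in> limiting_normal_cone B p" "u \<in> mink_diff L L" for u
    using rel_interior_normals_trivial[OF cv ri p _ _ that(3) L_def]
      limiting_normal_cone_convex[OF cv(1) that(1)] limiting_normal_cone_convex[OF cv(2) that(2)]
    by force
  moreover have "0 \<in> limiting_normal_cone A p" "0 \<in> limiting_normal_cone B p"
    using p zero_mem_orthogonal_comp orthogonal_comp_subset_limiting_normal_cone by blast+
  ultimately show ?thesis
    unfolding affine_hull_regular_def L_def[symmetric] V(1) using subspace_0[OF V(2)] by force
qed

text \<open>A small positive multiple of \<open>z\<close> is a difference \<open>b - a\<close>, and
  such differences are orthogonal to \<open>z\<close>.\<close>

lemma interior_mink_diff_orthogonal_comp:
  fixes A B :: "'a::euclidean_space set"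
  assumes "0 \<in> interior (mink_diff B A)" "A \<subseteq> L" "B \<subseteq> L" and z: "z \<in> orthogonal_comp (mink_diff L L)"
  shows "z = 0"
proof -
  obtain e where e: "0 < e" "ball 0 e \<subseteq> mink_diff B A" using assms(1) mem_interior by blast
  \<comment> \<open>The summand 1 keeps the divisor positive when \<open>z = 0\<close>.\<close>
  define K where "K = norm z + 1"
  have K: "0 < K" "norm z \<le> K" unfolding K_def using norm_ge_zero[of z] by linarith+
  define t where "t = e / (2 * K)"
  have t: "0 < t" using e K by (simp add: t_def)
  have "norm (t *\<^sub>R z) \<le> t * K" using t K by simp
  also have "\<dots> = e / 2" using K by (simp add: t_def)
  finally have "t *\<^sub>R z \<in> mink_diff B A" using e by (intro subsetD[OF e(2)]) simp
  then obtain b a where "t *\<^sub>R z = b - a" "b \<in> B" "a \<in> A" unfolding mink_diff_def by blast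
  then have "(t *\<^sub>R z) \<bullet> z = 0" using inner_orthogonal_comp_mink_diff[OF z, of b a] assms(2,3) by auto
  then show ?thesis using t by simp
qed

text \<open>A coercivity that holds for all admissible parameters: the gain controls the length of
  the step, though for \<open>l = m = 2\<close> not the residuals separately. This is enough for
  averagedness.\<close>

lemma gain_ge_step:
  assumes "admissible l m \<alpha>"
  obtains c where "0 < c" "\<And>u v :: 'a::euclidean_space. c * (norm (l *\<^sub>R u + m *\<^sub>R v))\<^sup>2 \<le> gain l m \<alpha> u v"
  using assms
proof (cases rule: admissible_cases)
  case 1
  have par: "0 < l" "l \<le> 2" "0 < m" "m \<le> 2" "\<alpha> < 1 + beta_hat l m" using assms by (auto simp: admissible_def)
  obtain k where k: "0 < k" "\<And>u v :: 'a. gain l m \<alpha> u v \<ge> k * ((norm u)\<^sup>2 + (norm v)\<^sup>2)"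
    using gain_bound[where 'a='a, OF par(1-4) 1 par(5)] by metis
  have "k / 8 * (norm (l *\<^sub>R u + m *\<^sub>R v))\<^sup>2 \<le> gain l m \<alpha> u v" for u v :: 'a
  proof -
    have "norm (l *\<^sub>R u + m *\<^sub>R v) \<le> l * norm u + m * norm v"
      using norm_triangle_ineq[of "l *\<^sub>R u" "m *\<^sub>R v"] par by simp
    also have "\<dots> \<le> 2 * norm u + 2 * norm v" using par by (intro add_mono mult_right_mono) auto
    finally have "(norm (l *\<^sub>R u + m *\<^sub>R v))\<^sup>2 \<le> (2 * norm u + 2 * norm v)\<^sup>2" by (intro power_mono) auto
    also have "\<dots> \<le> 8 * ((norm u)\<^sup>2 + (norm v)\<^sup>2)"
      using sum_squares_bound[of "norm u" "norm v"] by (simp add: power2_sum power_mult_distrib)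
    finally have "k / 8 * (norm (l *\<^sub>R u + m *\<^sub>R v))\<^sup>2 \<le> k / 8 * (8 * ((norm u)\<^sup>2 + (norm v)\<^sup>2))"
      using k by (intro mult_left_mono) auto
    also have "\<dots> = k * ((norm u)\<^sup>2 + (norm v)\<^sup>2)" by simp
    also have "\<dots> \<le> gain l m \<alpha> u v" by (rule k(2))
    finally show ?thesis .
  qed
  then show thesis using k(1) by (intro that[of "k / 8"]) auto
next
  case 2
  have "(1 - \<alpha>) * (norm (l *\<^sub>R u + m *\<^sub>R v))\<^sup>2 \<le> gain l m \<alpha> u v" for u v :: 'a
    using 2 by (simp add: gain_def)
  then show thesis using 2 by (intro that[of "1 - \<alpha>"]) auto
qed

section \<open>The averaged map of two convex sets and its fixed points\<close>

definition alg_map :: "'a::euclidean_space set \<Rightarrow> 'a set \<Rightarrow> real \<Rightarrow> real \<Rightarrow> real \<Rightarrow> 'a \<Rightarrow> 'a" where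
  "alg_map A B l m \<alpha> x =
     (let u = x - closest_point A x; r = x - l *\<^sub>R u in x - \<alpha> *\<^sub>R (l *\<^sub>R u + m *\<^sub>R (r - closest_point B r)))"

lemma alg_op_convex:
  assumes "convex A" "closed A" "A \<noteq> {}" "convex B" "closed B" "B \<noteq> {}"
  shows "alg_op A B l m \<alpha> x = {alg_map A B l m \<alpha> x}"
  by (rule set_eqI) (simp add: alg_op_iff proj_convex[OF assms(1-3)] proj_convex[OF assms(4-6)] alg_map_def Let_def)

text \<open>The descent estimate is applied to differences: \<open>d\<close> is
  \<open>x - y\<close>, and \<open>u\<close>, \<open>v\<close> are differences of residuals at the
  two points. The inner products are nonnegative because projections onto convex sets are firmly
  nonexpansive.\<close>

lemma alg_map_averaged:
  fixes A B :: "'a::euclidean_space set"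
  assumes A: "convex A" "closed A" "A \<noteq> {}" and B: "convex B" "closed B" "B \<noteq> {}"
    and adm: "admissible l m \<alpha>"
  defines "f \<equiv> alg_map A B l m \<alpha>"
  obtains c where "0 < c" "\<And>x y. (norm (f x - f y))\<^sup>2 \<le> (norm (x - y))\<^sup>2 - c * (norm ((x - f x) - (y - f y)))\<^sup>2"
proof -
  have par: "0 < l" "l \<le> 2" "0 < m" "m \<le> 2" "0 < \<alpha>" using adm by (auto simp: admissible_def)
  obtain c where c: "0 < c" "\<And>u v :: 'a. c * (norm (l *\<^sub>R u + m *\<^sub>R v))\<^sup>2 \<le> gain l m \<alpha> u v"
    using gain_ge_step[where 'a='a, OF adm] by metis
  have mono: "((x - closest_point S x) - (y - closest_point S y)) \<bullet> (closest_point S x - closest_point S y) \<ge> 0"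
    if "convex S" "closed S" "S \<noteq> {}" for S and x y :: 'a
    using closest_point_dot[OF that(1,2) closest_point_in_set[OF that(2,3)], of x y]
      closest_point_dot[OF that(1,2) closest_point_in_set[OF that(2,3)], of y x]
    by (simp add: inner_diff_left inner_diff_right)
  have "(norm (f x - f y))\<^sup>2 \<le> (norm (x - y))\<^sup>2 - (c / \<alpha>) * (norm ((x - f x) - (y - f y)))\<^sup>2" for x y
  proof -
    define r where "r x = x - l *\<^sub>R (x - closest_point A x)" for x
    define u where "u = (x - closest_point A x) - (y - closest_point A y)"
    define v where "v = (r x - closest_point B (r x)) - (r y - closest_point B (r y))"
    define s where "s = l *\<^sub>R u + m *\<^sub>R v"
    have f: "f x = x - \<alpha> *\<^sub>R (l *\<^sub>R (x - closest_point A x) + m *\<^sub>R (r x - closest_point B (r x)))" for x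
      by (simp add: f_def alg_map_def r_def Let_def)
    have ff: "f x - f y = (x - y) - \<alpha> *\<^sub>R s"
      unfolding f s_def u_def v_def by (simp add: algebra_simps)
    then have dd: "(x - f x) - (y - f y) = \<alpha> *\<^sub>R s" by (simp add: algebra_simps)
    have "(x - y) - u = closest_point A x - closest_point A y" by (simp add: u_def)
    then have 1: "u \<bullet> ((x - y) - u) \<ge> - 0" using mono[OF A, of x y] by (simp add: u_def)
    have "(x - y) - l *\<^sub>R u = r x - r y" by (simp add: u_def r_def algebra_simps)
    then have "(x - y) - l *\<^sub>R u - v = closest_point B (r x) - closest_point B (r y)" by (simp add: v_def)
    then have 2: "v \<bullet> ((x - y) - l *\<^sub>R u - v) \<ge> - 0" using mono[OF B, of "r x" "r y"] by (simp add: v_def)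
    have "(norm (f x - f y))\<^sup>2 \<le> (norm (x - y))\<^sup>2 - \<alpha> * gain l m \<alpha> u v"
      unfolding ff s_def using norm_step_le[OF _ _ _ _ _ 1 2, of \<alpha> m] par by simp
    also have "\<dots> \<le> (norm (x - y))\<^sup>2 - \<alpha> * (c * (norm s)\<^sup>2)"
      using c(2)[of u v] par by (simp add: s_def)
    also have "\<alpha> * (c * (norm s)\<^sup>2) = (c / \<alpha>) * (norm (\<alpha> *\<^sub>R s))\<^sup>2"
      using par by (simp add: power_mult_distrib power2_eq_square)
    finally show ?thesis unfolding dd .
  qed
  then show thesis using c(1) par by (intro that[of "c / \<alpha>"]) auto
qed

lemma averaged_imp_nonexpansive:
  assumes "0 < c" "(norm (f x - f y))\<^sup>2 \<le> (norm (x - y))\<^sup>2 - c * (norm ((x - f x) - (y - f y)))\<^sup>2"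
  shows "norm (f x - f y) \<le> norm (x - y)"
proof -
  have "0 \<le> c * (norm ((x - f x) - (y - f y)))\<^sup>2" using assms(1) by simp
  then have "(norm (f x - f y))\<^sup>2 \<le> (norm (x - y))\<^sup>2" using assms(2) by linarith
  then show ?thesis by (rule power2_le_imp_le) simp
qed

text \<open>The Krasnoselskii-Mann argument: distances to fixed points decrease, the residuals
  \<open>x n - f (x n)\<close> tend to 0, and so every cluster point is fixed.\<close>

lemma averaged_iteration_converges:
  fixes f :: "'a::euclidean_space \<Rightarrow> 'a"
  assumes c: "0 < c"
    and av: "\<And>x y. (norm (f x - f y))\<^sup>2 \<le> (norm (x - y))\<^sup>2 - c * (norm ((x - f x) - (y - f y)))\<^sup>2"
    and w: "f w = w" and x: "\<And>n. x (Suc n) = f (x n)"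
  obtains y where "f y = y" "x \<longlonglongrightarrow> y"
proof -
  have ne: "norm (f x - f y) \<le> norm (x - y)" for x y using averaged_imp_nonexpansive[OF c av] .
  have dec: "decseq (\<lambda>n. norm (x n - y))" if "f y = y" for y
    using ne[of _ y] that x by (intro decseq_SucI) auto
  then have conv: "convergent (\<lambda>n. norm (x n - y))" if "f y = y" for y
    using decseq_convergent[of "\<lambda>n. norm (x n - y)" 0] that by (metis convergentI norm_ge_zero)
  have "norm (x n - w) \<le> norm (x 0 - w)" for n using decseqD[OF dec[OF w], of 0 n] by simp
  then have "\<forall>n. x n \<in> cball w (norm (x 0 - w))" by (simp add: dist_norm norm_minus_commute)
  then obtain y s where y: "strict_mono s" "(x \<circ> s) \<longlonglongrightarrow> y"
    using compact_cball unfolding compact_def by metis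
  obtain a where a: "(\<lambda>n. norm (x n - w)) \<longlonglongrightarrow> a" using conv[OF w] by (auto simp: convergent_def)
  have "(\<lambda>n. (norm (x n - w))\<^sup>2 - (norm (x (Suc n) - w))\<^sup>2) \<longlonglongrightarrow> a\<^sup>2 - a\<^sup>2"
    by (intro tendsto_intros a LIMSEQ_Suc)
  then have "(\<lambda>n. ((norm (x n - w))\<^sup>2 - (norm (x (Suc n) - w))\<^sup>2) / c) \<longlonglongrightarrow> 0"
    using tendsto_divide[OF _ tendsto_const[of c]] c by fastforce
  moreover have "(norm (x n - f (x n)))\<^sup>2 \<le> ((norm (x n - w))\<^sup>2 - (norm (x (Suc n) - w))\<^sup>2) / c" for n
    using av[of "x n" w] w c x by (simp add: field_simps)
  ultimately have "(\<lambda>n. (norm (x n - f (x n)))\<^sup>2) \<longlonglongrightarrow> 0"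
    by (intro Lim_null_comparison[of "\<lambda>n. (norm (x n - f (x n)))\<^sup>2"]) auto
  then have "(\<lambda>n. sqrt ((norm (x n - f (x n)))\<^sup>2)) \<longlonglongrightarrow> sqrt 0" by (intro tendsto_real_sqrt)
  then have "(\<lambda>n. x n - f (x n)) \<longlonglongrightarrow> 0" by (simp add: tendsto_norm_zero_iff)
  then have 1: "(\<lambda>n. x (s n) - f (x (s n))) \<longlonglongrightarrow> 0"
    using LIMSEQ_subseq_LIMSEQ[OF _ y(1)] by (fastforce simp: o_def)
  have ys: "(\<lambda>n. x (s n)) \<longlonglongrightarrow> y" using y(2) by (simp add: o_def)
  have "(\<lambda>n. norm (x (s n) - y)) \<longlonglongrightarrow> 0" using ys by (simp add: tendsto_norm_zero_iff LIM_zero_iff)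
  then have "(\<lambda>n. f (x (s n)) - f y) \<longlonglongrightarrow> 0"
    by (rule Lim_null_comparison[rotated]) (simp add: ne)
  then have "(\<lambda>n. f (x (s n))) \<longlonglongrightarrow> f y" by (simp add: LIM_zero_iff)
  then have "(\<lambda>n. x (s n) - f (x (s n))) \<longlonglongrightarrow> y - f y" by (intro tendsto_diff ys)
  then have "0 = y - f y" by (rule LIMSEQ_unique[OF 1])
  then have fy: "f y = y" by simp
  \<comment> \<open>Monotonicity is now used for the cluster point itself: its distances to the
    sequence converge, and they vanish along the subsequence.\<close>
  obtain b where b: "(\<lambda>n. norm (x n - y)) \<longlonglongrightarrow> b" using conv[OF fy] by (auto simp: convergent_def)
  then have "(\<lambda>n. norm (x (s n) - y)) \<longlonglongrightarrow> b"
    using LIMSEQ_subseq_LIMSEQ[OF _ y(1)] by (fastforce simp: o_def)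
  then have "b = 0" using LIMSEQ_unique \<open>(\<lambda>n. norm (x (s n) - y)) \<longlonglongrightarrow> 0\<close> by blast
  then have "x \<longlonglongrightarrow> y" using b by (simp add: tendsto_norm_zero_iff LIM_zero_iff)
  then show thesis using that fy by blast
qed

text \<open>At a fixed point \<open>l *\<^sub>R u + m *\<^sub>R v = 0\<close>. If
  \<open>min l m < 2\<close>, coercivity forces both residuals to vanish. For
  \<open>l = m = 2\<close> it gives \<open>v = - u\<close>, so that \<open>p = q\<close> is a common
  point at which \<open>x - p\<close> is normal to \<open>A\<close> and its negative is normal to
  \<open>B\<close>.\<close>

lemma fixed_point_convex:
  fixes A B :: "'a::euclidean_space set"
  assumes cv: "convex A" "convex B" and c: "c \<in> A \<inter> B" and adm: "admissible l m \<alpha>"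
    and x: "x \<in> alg_op A B l m \<alpha> x"
  obtains p where "p \<in> A \<inter> B" "p \<in> proj A x" "min l m < 2 \<Longrightarrow> x = p"
    "\<And>b. b \<in> B \<Longrightarrow> (x - p) \<bullet> (b - p) \<ge> 0"
proof -
  have par: "0 < l" "l \<le> 2" "0 < m" "m \<le> 2" "0 < \<alpha>" "\<alpha> < 1 + beta_hat l m"
    using adm by (auto simp: admissible_def)
  obtain p q where p: "p \<in> proj A x" and q: "q \<in> proj B (x - l *\<^sub>R (x - p))"
    and x': "x = x - \<alpha> *\<^sub>R (l *\<^sub>R (x - p) + m *\<^sub>R (x - l *\<^sub>R (x - p) - q))"
    using x unfolding alg_op_iff by blast
  define u where "u = x - p"
  define v where "v = x - l *\<^sub>R u - q"
  have s: "l *\<^sub>R u + m *\<^sub>R v = 0" using x' par by (simp add: u_def v_def)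
  show thesis using adm
  proof (cases rule: admissible_cases)
    case 1
    obtain k where k: "0 < k" "\<And>u v :: 'a. gain l m \<alpha> u v \<ge> k * ((norm u)\<^sup>2 + (norm v)\<^sup>2)"
      using gain_bound[where 'a='a, OF par(1-4) 1 par(6)] by metis
    have 3: "u \<bullet> ((x - c) - u) \<ge> - 0"
      using proj_convex_inner_le[OF cv(1) p, of c] c by (simp add: u_def inner_diff_right)
    have 4: "v \<bullet> ((x - c) - l *\<^sub>R u - v) \<ge> - 0"
      using proj_convex_inner_le[OF cv(2) q, of c] c by (simp add: u_def v_def inner_diff_right)
    \<comment> \<open>The distance to \<open>c\<close> does not change in this step, so the gain
      cannot be positive.\<close>
    have "\<alpha> * gain l m \<alpha> u v \<le> 0"
      using norm_step_le[OF _ _ _ _ _ 3 4, of \<alpha> m] par s by simp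
    then have "gain l m \<alpha> u v \<le> 0" using par by (simp add: mult_le_0_iff)
    then have "k * ((norm u)\<^sup>2 + (norm v)\<^sup>2) \<le> 0" using k(2)[of u v] by linarith
    then have "(norm u)\<^sup>2 + (norm v)\<^sup>2 \<le> 0" using k(1) by (simp only: mult_le_0_iff) linarith
    then have "u = 0" "v = 0" by (simp_all add: sum_power2_le_zero_iff)
    then have "p = x" "q = x" by (auto simp: u_def v_def)
    then show thesis using that[of p] p projD(1)[OF p] projD(1)[OF q] by simp
  next
    case 2
    have uv: "v = - u" using s 2 by (simp add: eq_neg_iff_add_eq_0 add.commute flip: scaleR_add_right)
    then have pq: "q = p" using 2 by (simp add: v_def u_def algebra_simps scaleR_2)
    have "(x - p) \<bullet> (b - p) \<ge> 0" if "b \<in> B" for b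
    proof -
      have "v \<bullet> (b - q) \<le> 0"
        using proj_convex_inner_le[OF cv(2) q that] by (simp add: v_def u_def)
      then have "(- u) \<bullet> (b - p) \<le> 0" by (simp only: uv pq)
      then show ?thesis by (simp add: inner_minus_left u_def[symmetric])
    qed
    then show thesis using that[of p] p projD(1)[OF p] projD(1)[OF q] pq 2 by simp
  qed
qed

section \<open>From convergence to R-linear convergence for convex sets\<close>

lemma convex_iteration_converges:
  fixes A B :: "'a::euclidean_space set"
  assumes A: "convex A" "closed A" and B: "convex B" "closed B" and c: "c \<in> A \<inter> B"
    and adm: "admissible l m \<alpha>" and x: "\<And>n. x (Suc n) \<in> alg_op A B l m \<alpha> (x n)"
  obtains y where "x \<longlonglongrightarrow> y" "y \<in> alg_op A B l m \<alpha> y"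
proof -
  have ne: "A \<noteq> {}" "B \<noteq> {}" using c by auto
  note eq = alg_op_convex[OF A ne(1) B ne(2)]
  obtain k where k: "0 < k" "\<And>x y. (norm (alg_map A B l m \<alpha> x - alg_map A B l m \<alpha> y))\<^sup>2
      \<le> (norm (x - y))\<^sup>2 - k * (norm ((x - alg_map A B l m \<alpha> x) - (y - alg_map A B l m \<alpha> y)))\<^sup>2"
    using alg_map_averaged[OF A ne(1) B ne(2) adm] by metis
  have "alg_map A B l m \<alpha> c = c" using c by (simp add: alg_map_def closest_point_self)
  then obtain y where "alg_map A B l m \<alpha> y = y" "x \<longlonglongrightarrow> y"
    using averaged_iteration_converges[OF k, of c x] x eq by auto
  then show thesis using that eq by simp
qed

text \<open>Permits the use of a local theorem centred at the limit of the sequence: a tail enters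
  the required ball, and dropping finitely many terms affects neither the limit nor
  R-linearity.\<close>

lemma locally_converges_tail:
  assumes "locally_converges T y Q" "x \<longlonglongrightarrow> y" "\<And>n. x (Suc n) \<in> T (x n)"
  shows "R_linear_conv x y \<and> Q y"
proof -
  obtain r where r: "0 < r" "\<And>x. x 0 \<in> cball y r \<Longrightarrow> (\<forall>n. x (Suc n) \<in> T (x n)) \<Longrightarrow>
      \<exists>z. R_linear_conv x z \<and> Q z"
    using assms(1) unfolding locally_converges_def by blast
  obtain N where "dist (x N) y < r" using metric_LIMSEQ_D[OF assms(2) r(1)] by blast
  then have "x (0 + N) \<in> cball y r" by (simp add: dist_commute)
  then obtain z where z: "R_linear_conv (\<lambda>n. x (n + N)) z" "Q z"
    using r(2)[of "\<lambda>n. x (n + N)"] assms(3) by auto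
  then have "R_linear_conv x z" using R_linear_conv_shift by blast
  moreover then have "z = y" using R_linear_conv_tendsto assms(2) LIMSEQ_unique by blast
  ultimately show ?thesis using z by blast
qed

lemma globally_converges_boundedly_linearly_regular:
  fixes A B :: "'a::euclidean_space set"
  assumes A: "convex A" "closed A" and B: "convex B" "closed B" and c: "A \<inter> B \<noteq> {}"
    and adm: "admissible l m \<alpha>" "min l m < 2" and blr: "boundedly_linearly_regular A B"
  shows "globally_converges (alg_op A B l m \<alpha>) (\<lambda>y. y \<in> A \<inter> B)"
  unfolding globally_converges_def
proof (intro allI impI)
  fix x assume x: "\<forall>n. x (Suc n) \<in> alg_op A B l m \<alpha> (x n)"
  obtain c where c: "c \<in> A \<inter> B" using c by blast
  obtain y where y: "x \<longlonglongrightarrow> y" "y \<in> alg_op A B l m \<alpha> y"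
    using convex_iteration_converges[OF A B c adm(1)] x by metis
  obtain p where "p \<in> A \<inter> B" "min l m < 2 \<Longrightarrow> y = p"
    using fixed_point_convex[OF A(1) B(1) c adm(1) y(2)] by metis
  then have yAB: "y \<in> A \<inter> B" using adm by simp
  have "linearly_regular_around A B y"
    using blr bounded_cball zero_less_one unfolding boundedly_linearly_regular_def linearly_regular_around_def
    by metis
  then have "locally_converges (alg_op A B l m \<alpha>) y (\<lambda>y. y \<in> A \<inter> B)"
    using locally_converges_linearly_regular[OF A(2) B(2) yAB adm] convex_imp_superregular A B by blast
  then show "\<exists>xbar. R_linear_conv x xbar \<and> xbar \<in> A \<inter> B"
    using locally_converges_tail[OF _ y(1)] x by blast
qed

lemma globally_converges_rel_interior:
  fixes A B :: "'a::euclidean_space set"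
  assumes A: "convex A" "closed A" and B: "convex B" "closed B"
    and ri: "rel_interior A \<inter> rel_interior B \<noteq> {}"
    and adm: "admissible l m \<alpha>" and L: "L = affine hull (A \<union> B)"
  shows "globally_converges (alg_op A B l m \<alpha>) (\<lambda>xbar.
          xbar \<in> (A \<inter> B) + orthogonal_comp (mink_diff L L) \<and>
          (\<exists>p \<in> A \<inter> B. proj A xbar = {p} \<and> proj B xbar = {p}) \<and>
          (0 \<in> interior (mink_diff B A) \<longrightarrow> xbar \<in> A \<inter> B))"
proof -
  have AL: "affine L" "A \<subseteq> L" "B \<subseteq> L" by (auto simp: L hull_inc)
  obtain c where c: "c \<in> rel_interior A \<inter> rel_interior B" using ri by blast
  then have cAB: "c \<in> A \<inter> B" using rel_interior_subset by blast
  have cL: "c \<in> L" using cAB AL by blast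
  have "\<exists>y z. R_linear_conv x (y + z) \<and> y \<in> A \<inter> B \<and> z \<in> orthogonal_comp (mink_diff L L)"
    if x: "\<And>n. x (Suc n) \<in> alg_op A B l m \<alpha> (x n)" for x
    using adm
  proof (cases rule: admissible_cases)
    case 1
    obtain y where y: "x \<longlonglongrightarrow> y" "y \<in> alg_op A B l m \<alpha> y"
      using convex_iteration_converges[OF A B cAB adm, of x] x by metis
    obtain p where "p \<in> A \<inter> B" "min l m < 2 \<Longrightarrow> y = p"
      using fixed_point_convex[OF A(1) B(1) cAB adm y(2)] by metis
    then have yAB: "y \<in> A \<inter> B" using 1 by simp
    have "R_linear_conv x y"
      using locally_converges_tail[OF locally_converges_affine_hull_regular[OF A(2) B(2) yAB adm
          convex_imp_superregular[OF A(1)] convex_imp_superregular[OF B(1)]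
          rel_interior_imp_affine_hull_regular[OF A(1) B(1) c yAB] L] y(1) x] by blast
    then show ?thesis using yAB zero_mem_orthogonal_comp by (metis add.right_neutral)
  next
    case 2
    \<comment> \<open>The limit of \<open>x\<close> may lie outside \<open>A \<inter> B\<close>.
      Removing the orthogonal part of the start yields a sequence in \<open>L\<close> whose limit
      will turn out to be a common point.\<close>
    obtain z where z: "z \<in> orthogonal_comp (mink_diff L L)" "x 0 - z \<in> L"
      using affine_orthogonal_decomp[OF AL(1) cL] by metis
    note sh = alg_op_reflections_shift_sequence[of L A B x z, OF AL z(2,1) x[unfolded 2(1,2)]]
    obtain y where y: "(\<lambda>n. x n - z) \<longlonglongrightarrow> y" "y \<in> alg_op A B l m \<alpha> y"
      using convex_iteration_converges[OF A B cAB adm, of "\<lambda>n. x n - z"] sh(2) 2 by metis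
    have "y \<in> L" using closed_sequentially[OF closed_affine_hull[of "A \<union> B", folded L] _ y(1)] sh(1) by blast
    obtain p where p: "p \<in> A \<inter> B" "p \<in> proj A y" "\<And>b. b \<in> B \<Longrightarrow> (y - p) \<bullet> (b - p) \<ge> 0"
      using fixed_point_convex[OF A(1) B(1) cAB adm y(2)] by metis
    \<comment> \<open>The residual is parallel to \<open>L\<close>, normal to \<open>A\<close>, and
      its negative is normal to \<open>B\<close>; with a common relative interior point only 0 has
      these properties.\<close>
    have "y - p \<in> mink_diff L L" using p(1) AL \<open>y \<in> L\<close> by (auto simp: mink_diff_def)
    then have "y - p = 0"
      using rel_interior_normals_trivial[OF A(1) B(1) c p(1) proj_convex_inner_le[OF A(1) p(2)] p(3) _ L] by blast
    then have yAB: "y \<in> A \<inter> B" using p(1) by simp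
    obtain r where r: "0 < r"
      "\<And>x z. z \<in> orthogonal_comp (mink_diff L L) \<Longrightarrow> x 0 - z \<in> L \<Longrightarrow> norm (x 0 - z - y) \<le> r \<Longrightarrow>
       (\<And>n. x (Suc n) \<in> alg_op A B 2 2 \<alpha> (x n)) \<Longrightarrow> \<exists>y \<in> A \<inter> B. R_linear_conv x (y + z)"
      using reflections_local_convergence[OF A(2) B(2) yAB 2(4,3)
          convex_imp_superregular[OF A(1)] convex_imp_superregular[OF B(1)]
          rel_interior_imp_affine_hull_regular[OF A(1) B(1) c yAB] L] by metis
    obtain N where "dist (x N - z) y < r" using metric_LIMSEQ_D[OF y(1) r(1)] by blast
    then have "norm (x (0 + N) - z - y) \<le> r" by (simp add: dist_norm)
    then obtain y' where y': "y' \<in> A \<inter> B" "R_linear_conv (\<lambda>n. x (n + N)) (y' + z)"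
      using r(2)[of z "\<lambda>n. x (n + N)"] z sh x 2 by auto
    then show ?thesis using R_linear_conv_shift z(1) by blast
  qed
  then show ?thesis
    unfolding globally_converges_def
    using shifted_common_point[OF AL(2,3)] interior_mink_diff_orthogonal_comp[OF _ AL(2,3)]
    by (metis add.right_neutral)
qed

section \<open>Polyhedra\<close>

lemma closest_point_eqI:
  fixes S :: "'a::euclidean_space set"
  assumes "convex S" "closed S" "q \<in> S" "\<And>a. a \<in> S \<Longrightarrow> (x - q) \<bullet> (a - q) \<le> 0"
  shows "closest_point S x = q"
proof -
  have "dist x q \<le> dist x a" if "a \<in> S" for a
  proof -
    have "(norm (x - a))\<^sup>2 = (norm (x - q))\<^sup>2 + (norm (a - q))\<^sup>2 - 2 * ((x - q) \<bullet> (a - q))"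
      using power2_norm_eq_inner[of "(x - q) - (a - q)"]
      by (simp add: power2_norm_eq_inner inner_diff_left inner_diff_right inner_commute)
    then have "(norm (x - q))\<^sup>2 \<le> (norm (x - a))\<^sup>2"
      using assms(4)[OF that] zero_le_power2[of "norm (a - q)"] by linarith
    then show ?thesis unfolding dist_norm by (rule power2_le_imp_le) simp
  qed
  then show ?thesis using closest_point_unique[OF assms(1-3)] by simp
qed

text \<open>A weak form of piecewise affinity: each ray from \<open>x\<close> has its own affine
  formula, on a length uniform over the rays. It passes to compositions without any record of the
  pieces.\<close>

definition radially_affine_at :: "('a::euclidean_space \<Rightarrow> 'a) \<Rightarrow> 'a \<Rightarrow> bool" where
  "radially_affine_at f x \<longleftrightarrow> (\<exists>r>0. \<forall>y t. norm y \<le> r \<longrightarrow> 0 \<le> t \<longrightarrow> t \<le> 1 \<longrightarrow>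
     f (x + t *\<^sub>R y) = f x + t *\<^sub>R (f (x + y) - f x))"

text \<open>Let \<open>p\<close> and \<open>q\<close> be the projections of \<open>x\<close> and of
  a nearby \<open>x + y\<close>. The constraints active at \<open>q\<close> are active at
  \<open>p\<close>, hence at every \<open>q'\<close> between them, and both residuals are normal at
  \<open>q\<close>, hence at \<open>q'\<close>. Their convex combination is the residual that
  identifies \<open>q'\<close> as a projection.\<close>

lemma polyhedron_closest_point_radially_affine:
  fixes S :: "'a::euclidean_space set"
  assumes "polyhedron S" "S \<noteq> {}"
  shows "radially_affine_at (closest_point S) x"
proof -
  obtain F where F: "finite F" "S = \<Inter> F" "\<And>h. h \<in> F \<Longrightarrow> \<exists>a b. h = {x. a \<bullet> x \<le> b}"
    using assms(1) unfolding polyhedron_def by metis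
  then obtain a b where h: "\<And>h. h \<in> F \<Longrightarrow> h = {x. a h \<bullet> x \<le> b h}" by metis
  have S_iff: "y \<in> S \<longleftrightarrow> (\<forall>h\<in>F. a h \<bullet> y \<le> b h)" for y using F(2) h by blast
  have cv: "convex S" "closed S"
    using assms(1) polyhedron_imp_convex polyhedron_imp_closed by blast+
  define P where "P = closest_point S"
  have PS: "P z \<in> S" for z unfolding P_def using closest_point_in_set[OF cv(2) assms(2)] .
  have cont: "(P \<longlongrightarrow> P x) (nhds x)"
    using continuous_at_closest_point[OF cv assms(2)] unfolding P_def
    by (simp add: continuous_at tendsto_at_iff_tendsto_nhds)
  define act where "act q = {h \<in> F. a h \<bullet> q = b h}" for q
  define N where "N q = {u. \<forall>y\<in>S. u \<bullet> (y - q) \<le> 0}" for q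
  have PN: "z - P z \<in> N (P z)" for z
    unfolding N_def P_def using closest_point_dot[OF cv(1,2)] by blast
  \<comment> \<open>the normal cone of a polyhedron only depends, monotonically, on the active constraints\<close>
  have N_mono: "N q \<subseteq> N q'" if q: "q \<in> S" "q' \<in> S" "act q \<subseteq> act q'" for q q'
  proof
    fix u assume u: "u \<in> N q"
    \<comment> \<open>Starting at \<open>q\<close>, a short move in direction \<open>y - q'\<close>
      stays in \<open>S\<close>: constraints active at \<open>q\<close> are also active at
      \<open>q'\<close> and do not increase towards \<open>y\<close>, and the others have slack.
      Normality of \<open>u\<close> at \<open>q\<close> then gives the sign.\<close>
    have "u \<bullet> (y - q') \<le> 0" if y: "y \<in> S" for y
    proof -
      have "\<forall>\<^sub>F t in at_right 0. a h \<bullet> (q + t *\<^sub>R (y - q')) \<le> b h" if h: "h \<in> F" for h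
      proof (cases "h \<in> act q")
        case True
        then have "a h \<bullet> q = b h" "a h \<bullet> q' = b h" using q(3) by (auto simp: act_def)
        moreover have "a h \<bullet> y \<le> b h" using y h S_iff by blast
        ultimately have "a h \<bullet> (q + t *\<^sub>R (y - q')) \<le> b h" if "0 < t" for t
          using that by (simp add: inner_add_right inner_diff_right mult_nonneg_nonpos)
        then show ?thesis by (auto simp: eventually_at_right_less intro: eventually_mono[OF eventually_at_right_less])
      next
        case False
        then have lt: "a h \<bullet> q < b h" using q(1) h S_iff by (fastforce simp: act_def)
        have "((\<lambda>t. a h \<bullet> (q + t *\<^sub>R (y - q'))) \<longlongrightarrow> a h \<bullet> (q + 0 *\<^sub>R (y - q'))) (at_right 0)"
          by (intro tendsto_intros)
        then have "\<forall>\<^sub>F t in at_right 0. a h \<bullet> (q + t *\<^sub>R (y - q')) < b h"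
          using lt by (intro order_tendstoD(2)[of _ "a h \<bullet> q"]) auto
        then show ?thesis by (rule eventually_mono) simp
      qed
      then have "\<forall>\<^sub>F t in at_right (0::real). \<forall>h\<in>F. a h \<bullet> (q + t *\<^sub>R (y - q')) \<le> b h"
        using F(1) by (simp add: eventually_ball_finite)
      then have "\<forall>\<^sub>F t in at_right (0::real). q + t *\<^sub>R (y - q') \<in> S \<and> 0 < t"
        using eventually_at_right_less by (intro eventually_conj) (auto simp: S_iff)
      then obtain t :: real where t: "q + t *\<^sub>R (y - q') \<in> S" "0 < t"
        using eventually_happens[of _ "at_right (0::real)"] trivial_limit_at_right_real by blast
      then have "u \<bullet> (q + t *\<^sub>R (y - q') - q) \<le> 0" using u unfolding N_def by blast
      then show ?thesis using t(2) by (simp add: mult_le_0_iff)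
    qed
    then show "u \<in> N q'" by (simp add: N_def)
  qed
  \<comment> \<open>Slack of a constraint at \<open>P x\<close> persists nearby by continuity of the
    projection.\<close>
  have ev1: "\<forall>\<^sub>F z in nhds x. act (P z) \<subseteq> act (P x)"
  proof -
    have "\<forall>\<^sub>F z in nhds x. h \<in> act (P z) \<longrightarrow> h \<in> act (P x)" if h: "h \<in> F" for h
    proof (cases "h \<in> act (P x)")
      case False
      then have "a h \<bullet> P x < b h" using PS[of x] h S_iff by (fastforce simp: act_def)
      moreover have "((\<lambda>z. a h \<bullet> P z) \<longlongrightarrow> a h \<bullet> P x) (nhds x)" by (intro tendsto_intros cont)
      ultimately have "\<forall>\<^sub>F z in nhds x. a h \<bullet> P z < b h" by (intro order_tendstoD(2))
      then show ?thesis by (rule eventually_mono) (auto simp: act_def)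
    qed auto
    then have "\<forall>\<^sub>F z in nhds x. \<forall>h\<in>F. h \<in> act (P z) \<longrightarrow> h \<in> act (P x)"
      using F(1) by (simp add: eventually_ball_finite)
    then show ?thesis by (rule eventually_mono) (auto simp: act_def)
  qed
  \<comment> \<open>The normal cone at \<open>P z\<close> is determined by its active set, and there
    are finitely many of these. If \<open>x - P x\<close> misses the closed cone belonging to
    \<open>J\<close>, so does \<open>z - P z\<close> for \<open>z\<close> near \<open>x\<close>, and
    \<open>J\<close> is not the active set of such a \<open>P z\<close>.\<close>
  have ev2: "\<forall>\<^sub>F z in nhds x. x - P x \<in> N (P z)"
  proof -
    have "\<forall>\<^sub>F z in nhds x. act (P z) = J \<longrightarrow> x - P x \<in> N (P z)" for J
    proof (cases "\<exists>z0. act (P z0) = J \<and> x - P x \<notin> N (P z0)")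
      case True
      then obtain z0 where z0: "act (P z0) = J" "x - P x \<notin> N (P z0)" by blast
      have "N (P z0) = (\<Inter>y\<in>S. {u. (y - P z0) \<bullet> u \<le> 0})" by (auto simp: N_def inner_commute)
      also have "closed \<dots>" by (intro closed_INT ballI closed_halfspace_le)
      finally have "open (- N (P z0))" by (rule open_Compl)
      moreover have "((\<lambda>z. z - P z) \<longlongrightarrow> x - P x) (nhds x)"
        by (intro tendsto_diff cont) (simp add: filterlim_ident)
      ultimately have "\<forall>\<^sub>F z in nhds x. z - P z \<in> - N (P z0)"
        using z0(2) by (intro topological_tendstoD) auto
      then show ?thesis
        by (rule eventually_mono) (use PN N_mono[OF PS PS] z0(1) in blast)
    qed auto
    then have "\<forall>\<^sub>F z in nhds x. \<forall>J\<in>Pow F. act (P z) = J \<longrightarrow> x - P x \<in> N (P z)"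
      using F(1) by (intro eventually_ball_finite) auto
    then show ?thesis by (rule eventually_mono) (auto simp: act_def)
  qed
  obtain e where e: "0 < e" "\<And>z. dist z x < e \<Longrightarrow> act (P z) \<subseteq> act (P x) \<and> x - P x \<in> N (P z)"
    using eventually_conj[OF ev1 ev2] unfolding eventually_nhds_metric by blast
  have "P (x + t *\<^sub>R y) = P x + t *\<^sub>R (P (x + y) - P x)"
    if y: "norm y \<le> e / 2" and t: "0 \<le> t" "t \<le> 1" for y t
  proof -
    define p where "p = P x"
    define q where "q = P (x + y)"
    define q' where "q' = p + t *\<^sub>R (q - p)"
    have pq: "p \<in> S" "q \<in> S" using PS by (auto simp: p_def q_def)
    have "dist (x + y) x < e" using y e(1) by (simp add: dist_norm)
    then have near: "act q \<subseteq> act p" "x - p \<in> N q" using e(2) by (auto simp: p_def q_def)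
    have q': "q' \<in> S"
      using convexD_alt[OF cv(1) pq t] by (simp add: q'_def algebra_simps)
    have "act q \<subseteq> act q'" using near(1) by (auto simp: act_def q'_def inner_add_right inner_diff_right)
    then have "N q \<subseteq> N q'" using N_mono pq(2) q' by blast
    moreover have "x + y - q \<in> N q" using PN by (simp add: q_def)
    ultimately have nn: "x - p \<in> N q'" "x + y - q \<in> N q'" using near(2) by auto
    have eq: "x + t *\<^sub>R y - q' = (1 - t) *\<^sub>R (x - p) + t *\<^sub>R (x + y - q)"
      by (simp add: q'_def algebra_simps)
    have "(x + t *\<^sub>R y - q') \<bullet> (c - q') \<le> 0" if "c \<in> S" for c
    proof -
      have "(x - p) \<bullet> (c - q') \<le> 0" "(x + y - q) \<bullet> (c - q') \<le> 0"
        using nn that unfolding N_def by blast+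
      then have "(1 - t) * ((x - p) \<bullet> (c - q')) \<le> 0" "t * ((x + y - q) \<bullet> (c - q')) \<le> 0"
        using t by (auto intro: mult_nonneg_nonpos)
      then show ?thesis unfolding eq by (simp only: inner_add_left inner_scaleR_left)
    qed
    then have "P (x + t *\<^sub>R y) = q'" unfolding P_def by (intro closest_point_eqI cv q')
    then show ?thesis by (simp add: q'_def p_def q_def)
  qed
  then show ?thesis
    unfolding radially_affine_at_def P_def[symmetric] using e(1) by (intro exI[of _ "e / 2"]) auto
qed

lemma alg_map_radially_affine:
  fixes A B :: "'a::euclidean_space set"
  assumes A: "polyhedron A" "A \<noteq> {}" and B: "polyhedron B" "B \<noteq> {}" and l: "0 \<le> l" "l \<le> 2"
  shows "radially_affine_at (alg_map A B l m \<alpha>) x"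
proof -
  define R where "R x = x - l *\<^sub>R (x - closest_point A x)" for x
  have f: "alg_map A B l m \<alpha> x = x - \<alpha> *\<^sub>R (l *\<^sub>R (x - closest_point A x) + m *\<^sub>R (R x - closest_point B (R x)))" for x
    by (simp add: alg_map_def R_def Let_def)
  obtain r1 where r1: "0 < r1" "\<And>y t. norm y \<le> r1 \<Longrightarrow> 0 \<le> t \<Longrightarrow> t \<le> 1 \<Longrightarrow>
     closest_point A (x + t *\<^sub>R y) = closest_point A x + t *\<^sub>R (closest_point A (x + y) - closest_point A x)"
    using polyhedron_closest_point_radially_affine[OF A, of x] unfolding radially_affine_at_def by metis
  obtain r2 where r2: "0 < r2" "\<And>y t. norm y \<le> r2 \<Longrightarrow> 0 \<le> t \<Longrightarrow> t \<le> 1 \<Longrightarrow>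
     closest_point B (R x + t *\<^sub>R y)
       = closest_point B (R x) + t *\<^sub>R (closest_point B (R x + y) - closest_point B (R x))"
    using polyhedron_closest_point_radially_affine[OF B, of "R x"] unfolding radially_affine_at_def by metis
  \<comment> \<open>The relaxed projection \<open>R\<close> expands differences at most by the
    factor 5, namely \<open>1 + 2 * l\<close> for \<open>l \<le> 2\<close>; this is where
    \<open>r2 / 5\<close> comes from.\<close>
  have "alg_map A B l m \<alpha> (x + t *\<^sub>R y)
      = alg_map A B l m \<alpha> x + t *\<^sub>R (alg_map A B l m \<alpha> (x + y) - alg_map A B l m \<alpha> x)"
    if y: "norm y \<le> min r1 (r2 / 5)" and t: "0 \<le> t" "t \<le> 1" for y t
  proof -
    have a: "closest_point A (x + t *\<^sub>R y) = closest_point A x + t *\<^sub>R (closest_point A (x + y) - closest_point A x)"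
      using r1(2)[OF _ t, of y] y by simp
    have Ra: "R (x + t *\<^sub>R y) = R x + t *\<^sub>R (R (x + y) - R x)"
      unfolding R_def a by (simp add: algebra_simps)
    have "norm (closest_point A (x + y) - closest_point A x) \<le> norm y"
      using closest_point_lipschitz[OF polyhedron_imp_convex[OF A(1)] polyhedron_imp_closed[OF A(1)] A(2), of "x + y" x]
      by (simp add: dist_norm)
    then have "norm (y - (closest_point A (x + y) - closest_point A x)) \<le> 2 * norm y"
      using norm_triangle_ineq4[of y "closest_point A (x + y) - closest_point A x"] by simp
    then have "l * norm (y - (closest_point A (x + y) - closest_point A x)) \<le> 2 * (2 * norm y)"
      using l by (intro mult_mono) auto
    moreover have "R (x + y) - R x = y - l *\<^sub>R (y - (closest_point A (x + y) - closest_point A x))"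
      by (simp add: R_def algebra_simps)
    ultimately have "norm (R (x + y) - R x) \<le> 5 * norm y"
      using norm_triangle_ineq4[of y "l *\<^sub>R (y - (closest_point A (x + y) - closest_point A x))"] l by simp
    then have "norm (R (x + y) - R x) \<le> r2" using y by simp
    then have b: "closest_point B (R (x + t *\<^sub>R y))
        = closest_point B (R x) + t *\<^sub>R (closest_point B (R (x + y)) - closest_point B (R x))"
      unfolding Ra using r2(2)[OF _ t, of "R (x + y) - R x"] by simp
    show ?thesis unfolding f a b unfolding Ra by (simp add: algebra_simps)
  qed
  then show ?thesis
    unfolding radially_affine_at_def using r1(1) r2(1) by (intro exI[of _ "min r1 (r2 / 5)"]) auto
qed

text \<open>Averagedness alone gives no rate. It turns into a contraction towards \<open>w\<close>
  once the residual is at least a fixed multiple of the distance to \<open>w\<close>, and radial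
  affinity makes that ratio depend only on the direction, so that compactness of a sphere can be
  used.\<close>

lemma averaged_radially_affine_R_linear_conv:
  fixes f :: "'a::euclidean_space \<Rightarrow> 'a"
  assumes c: "0 < c"
    and av: "\<And>x y. (norm (f x - f y))\<^sup>2 \<le> (norm (x - y))\<^sup>2 - c * (norm ((x - f x) - (y - f y)))\<^sup>2"
    and fw: "f w = w" and ra: "radially_affine_at f w"
    and x: "\<And>n. x (Suc n) = f (x n)" and lim: "x \<longlonglongrightarrow> w"
  shows "R_linear_conv x w"
proof -
  obtain r where r: "0 < r" "\<And>y t. norm y \<le> r \<Longrightarrow> 0 \<le> t \<Longrightarrow> t \<le> 1 \<Longrightarrow>
     f (w + t *\<^sub>R y) = w + t *\<^sub>R (f (w + y) - w)"
    using ra fw unfolding radially_affine_at_def by auto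
  have ne: "norm (f x - f y) \<le> norm (x - y)" for x y using averaged_imp_nonexpansive[OF c av] .
  define g where "g y = f (w + y) - w" for y
  define y where "y n = x n - w" for n
  have yS: "y (Suc n) = g (y n)" for n by (simp add: y_def g_def x)
  have y_lim: "y \<longlonglongrightarrow> 0" using lim unfolding y_def by (simp add: LIM_zero_iff)
  have g_hom: "g (t *\<^sub>R v) = t *\<^sub>R g v" if "norm v \<le> r" "0 \<le> t" "t \<le> 1" for v t
    using r(2)[OF that] by (simp add: g_def)
  have g_ne: "norm (g u - g v) \<le> norm (u - v)" for u v using ne[of "w + u" "w + v"] by (simp add: g_def)
  \<comment> \<open>the distances to the fixed point \<open>w + v\<close> decrease to \<open>norm v\<close>, so \<open>y n\<close> is almost polar to \<open>v\<close>\<close>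
  have polar: "2 * (y n \<bullet> v) \<le> (norm (y n))\<^sup>2" if v: "g v = v" for n v
  proof -
    have "decseq (\<lambda>n. norm (y n - v))"
      using g_ne[of _ v] v by (intro decseq_SucI) (simp add: yS)
    moreover have "(\<lambda>n. norm (y n - v)) \<longlonglongrightarrow> norm (0 - v)" by (intro tendsto_intros y_lim)
    ultimately have "norm (0 - v) \<le> norm (y n - v)" by (rule decseq_ge)
    then have "(norm v)\<^sup>2 \<le> (norm (y n - v))\<^sup>2" by (intro power_mono) auto
    then show ?thesis
      by (simp add: power2_norm_eq_inner inner_diff_left inner_diff_right inner_commute)
  qed
  obtain N0 where N0: "\<And>n. N0 \<le> n \<Longrightarrow> norm (y n) \<le> r"
    using LIMSEQ_D[OF y_lim r(1)] by (auto intro: less_imp_le)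
  \<comment> \<open>The bound is claimed only along the sequence: \<open>w\<close> need not be
    isolated among the fixed points, so it can fail on a full neighbourhood.\<close>
  have "\<exists>\<epsilon>>0. \<exists>N. \<forall>n\<ge>N. \<epsilon> * norm (y n) \<le> norm (y n - g (y n))"
  proof (rule ccontr)
    assume neg: "\<not> ?thesis"
    define e where "e k = inverse (real (Suc k))" for k
    have "\<exists>n\<ge>max N0 k. norm (y n - g (y n)) < e k * norm (y n)" for k
    proof -
      have "0 < e k" by (simp add: e_def)
      then show ?thesis using neg by (meson not_le)
    qed
    then obtain n where n: "\<And>k. max N0 k \<le> n k" "\<And>k. norm (y (n k) - g (y (n k))) < e k * norm (y (n k))"
      by metis
    define d where "d k = y (n k)" for k
    have d: "0 < norm (d k)" "norm (d k) \<le> r" "norm (d k - g (d k)) \<le> e k * norm (d k)" for k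
      using n(1)[of k] n(2)[of k] N0[of "n k"] le_less_trans[OF norm_ge_zero n(2)[of k]]
      by (auto simp: d_def zero_less_mult_iff)
    have d_lim: "d \<longlonglongrightarrow> 0"
    proof -
      have "filterlim n at_top sequentially"
        by (rule filterlim_at_top_mono[OF filterlim_ident]) (use n(1) in auto)
      then have "(\<lambda>k. y (n k)) \<longlonglongrightarrow> 0" by (rule filterlim_compose[OF y_lim])
      moreover have "d = (\<lambda>k. y (n k))" by (simp add: d_def fun_eq_iff)
      ultimately show ?thesis by simp
    qed
    \<comment> \<open>Homogeneity of \<open>g\<close> transports the relative residual of the small
      vector \<open>d k\<close> to the sphere of radius \<open>r\<close>, where limits of directions
      exist.\<close>
    define z where "z k = (r / norm (d k)) *\<^sub>R d k" for k
    have nz: "norm (z k) = r" for k using d(1)[of k] r(1) by (simp add: z_def)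
    have zg: "norm (z k - g (z k)) \<le> r * e k" for k
    proof -
      have "d k = (norm (d k) / r) *\<^sub>R z k" using d(1)[of k] r(1) by (simp add: z_def)
      then have "g (d k) = (norm (d k) / r) *\<^sub>R g (z k)"
        using g_hom[of "z k" "norm (d k) / r"] nz[of k] d[of k] r(1) by simp
      then have "g (z k) = (r / norm (d k)) *\<^sub>R g (d k)" using d(1)[of k] r(1) by simp
      then have "z k - g (z k) = (r / norm (d k)) *\<^sub>R (d k - g (d k))" by (simp add: z_def algebra_simps)
      then have "norm (z k - g (z k)) = (r / norm (d k)) * norm (d k - g (d k))" using r(1) by simp
      also have "\<dots> \<le> (r / norm (d k)) * (e k * norm (d k))" using d[of k] r(1) by (intro mult_left_mono) auto
      finally show ?thesis using d(1)[of k] by simp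
    qed
    have "\<forall>k. z k \<in> sphere 0 r" using nz by simp
    then obtain v s where v: "v \<in> sphere 0 r" "strict_mono s" "(z \<circ> s) \<longlonglongrightarrow> v"
      using compact_sphere unfolding compact_def by metis
    have zs: "(\<lambda>k. z (s k)) \<longlonglongrightarrow> v" using v(3) by (simp add: o_def)
    have "(\<lambda>k. norm (z (s k) - v)) \<longlonglongrightarrow> 0" using zs by (simp add: tendsto_norm_zero_iff LIM_zero_iff)
    then have "(\<lambda>k. g (z (s k)) - g v) \<longlonglongrightarrow> 0"
      by (rule Lim_null_comparison[rotated]) (simp add: g_ne)
    then have "(\<lambda>k. g (z (s k))) \<longlonglongrightarrow> g v" by (simp add: LIM_zero_iff)
    then have 1: "(\<lambda>k. z (s k) - g (z (s k))) \<longlonglongrightarrow> v - g v" by (intro tendsto_diff zs)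
    have "(\<lambda>k. e (s k)) \<longlonglongrightarrow> 0"
      using LIMSEQ_subseq_LIMSEQ[OF LIMSEQ_inverse_real_of_nat v(2)] by (simp add: o_def e_def)
    then have "(\<lambda>k. r * e (s k)) \<longlonglongrightarrow> 0" by (rule tendsto_mult_right_zero)
    then have "(\<lambda>k. z (s k) - g (z (s k))) \<longlonglongrightarrow> 0"
      by (rule Lim_null_comparison[rotated]) (simp add: zg)
    then have "v - g v = 0" by (rule LIMSEQ_unique[OF 1])
    then have gv: "g v = v" by simp
    \<comment> \<open>The polar inequality is quadratic in \<open>d k\<close> on the right; after
      rescaling it still tends to 0, whereas the left side tends to \<open>v \<bullet> v\<close>,
      which is positive on the sphere.\<close>
    have "z k \<bullet> v \<le> r / 2 * norm (d k)" for k
    proof -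
      have "z k \<bullet> v = (r / norm (d k)) * (d k \<bullet> v)" by (simp add: z_def)
      also have "\<dots> \<le> (r / norm (d k)) * ((norm (d k))\<^sup>2 / 2)"
        using polar[OF gv, of "n k"] r(1) d(1)[of k] by (intro mult_left_mono) (auto simp: d_def)
      also have "\<dots> = r / 2 * norm (d k)" using d(1)[of k] by (simp add: power2_eq_square)
      finally show ?thesis .
    qed
    then have "z (s k) \<bullet> v \<le> r / 2 * norm (d (s k))" for k .
    moreover have "(\<lambda>k. z (s k) \<bullet> v) \<longlonglongrightarrow> v \<bullet> v" by (intro tendsto_intros zs)
    moreover have "(\<lambda>k. r / 2 * norm (d (s k))) \<longlonglongrightarrow> r / 2 * norm (0 :: 'a)"
      using LIMSEQ_subseq_LIMSEQ[OF d_lim v(2)] by (intro tendsto_intros) (simp add: o_def)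
    ultimately have "v \<bullet> v \<le> r / 2 * norm (0 :: 'a)" by (meson LIMSEQ_le)
    then show False using v(1) r(1) by (simp add: power2_norm_eq_inner[symmetric])
  qed
  then obtain \<epsilon> N where eN: "0 < \<epsilon>" "\<And>n. N \<le> n \<Longrightarrow> \<epsilon> * norm (y n) \<le> norm (y n - g (y n))" by blast
  \<comment> \<open>Comparison with the fixed point \<open>w\<close> makes the squared distance drop
    by the factor \<open>1 - c * \<epsilon>\<^sup>2\<close>; the maximum with 0 keeps the argument
    of the root nonnegative.\<close>
  define \<rho> where "\<rho> = sqrt (max 0 (1 - c * \<epsilon>\<^sup>2))"
  have "0 < c * \<epsilon>\<^sup>2" using c eN by simp
  then have \<rho>: "0 \<le> \<rho>" "\<rho> < 1" "1 - c * \<epsilon>\<^sup>2 \<le> \<rho>\<^sup>2" by (auto simp: \<rho>_def)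
  have step: "norm (y (Suc n)) \<le> \<rho> * norm (y n)" if n: "N \<le> n" for n
  proof -
    have "(\<epsilon> * norm (y n))\<^sup>2 \<le> (norm (y n - g (y n)))\<^sup>2" using eN(1,2) n by (intro power_mono) auto
    then have "c * (\<epsilon> * norm (y n))\<^sup>2 \<le> c * (norm (y n - g (y n)))\<^sup>2" using c by simp
    moreover have "(norm (y (Suc n)))\<^sup>2 \<le> (norm (y n))\<^sup>2 - c * (norm (y n - g (y n)))\<^sup>2"
      using av[of "x n" w] fw by (simp add: y_def g_def x algebra_simps)
    ultimately have "(norm (y (Suc n)))\<^sup>2 \<le> (1 - c * \<epsilon>\<^sup>2) * (norm (y n))\<^sup>2"
      by (simp add: power_mult_distrib algebra_simps)
    also have "\<dots> \<le> \<rho>\<^sup>2 * (norm (y n))\<^sup>2" using \<rho>(3) by (intro mult_right_mono) auto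
    finally have "(norm (y (Suc n)))\<^sup>2 \<le> (\<rho> * norm (y n))\<^sup>2" by (simp add: power_mult_distrib)
    then show ?thesis by (rule power2_le_imp_le) (use \<rho> in simp)
  qed
  have "norm (y (n + N)) \<le> norm (y N) * \<rho> ^ n" for n
  proof (induction n)
    case (Suc n)
    have "norm (y (Suc n + N)) \<le> \<rho> * norm (y (n + N))" using step[of "n + N"] by simp
    also have "\<dots> \<le> \<rho> * (norm (y N) * \<rho> ^ n)" using Suc \<rho> by (intro mult_left_mono) auto
    finally show ?case by (simp add: mult_ac)
  qed simp
  then have "R_linear_conv (\<lambda>n. x (n + N)) w"
    unfolding R_linear_conv_def y_def using \<rho> by (intro exI[of _ \<rho>] exI[of _ "norm (x N - w)"]) auto
  then show ?thesis by (rule R_linear_conv_shift)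
qed

section \<open>Limits and fixed points for polyhedra\<close>

lemma globally_converges_polyhedron:
  fixes A B :: "'a::euclidean_space set"
  assumes A: "polyhedron A" and B: "polyhedron B" and AB: "A \<inter> B \<noteq> {}" and adm: "admissible l m \<alpha>"
  shows "globally_converges (alg_op A B l m \<alpha>) (\<lambda>xbar.
          xbar \<in> Fix (alg_op A B l m \<alpha>) \<and> (\<exists>p \<in> A \<inter> B. proj A xbar = {p}))"
  unfolding globally_converges_def
proof (intro allI impI)
  fix x assume x: "\<forall>n. x (Suc n) \<in> alg_op A B l m \<alpha> (x n)"
  obtain c where c: "c \<in> A \<inter> B" using AB by blast
  have A': "convex A" "closed A" and B': "convex B" "closed B"
    using A B polyhedron_imp_convex polyhedron_imp_closed by blast+
  have ne: "A \<noteq> {}" "B \<noteq> {}" using c by auto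
  note eq = alg_op_convex[OF A' ne(1) B' ne(2)]
  obtain k where k: "0 < k" "\<And>x y. (norm (alg_map A B l m \<alpha> x - alg_map A B l m \<alpha> y))\<^sup>2
      \<le> (norm (x - y))\<^sup>2 - k * (norm ((x - alg_map A B l m \<alpha> x) - (y - alg_map A B l m \<alpha> y)))\<^sup>2"
    using alg_map_averaged[OF A' ne(1) B' ne(2) adm] by metis
  obtain y where y: "x \<longlonglongrightarrow> y" "y \<in> alg_op A B l m \<alpha> y"
    using convex_iteration_converges[OF A' B' c adm, of x] x by metis
  have "R_linear_conv x y"
    using averaged_radially_affine_R_linear_conv[OF k, of y x]
      alg_map_radially_affine[OF A ne(1) B ne(2), of l m \<alpha> y] adm x y
    by (auto simp: eq admissible_def)
  moreover obtain p where "p \<in> A \<inter> B" "p \<in> proj A y"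
    using fixed_point_convex[OF A'(1) B'(1) c adm y(2)] by metis
  then have "\<exists>p \<in> A \<inter> B. proj A y = {p}" using proj_convex[OF A' ne(1), of y] by auto
  ultimately show "\<exists>xbar. R_linear_conv x xbar \<and> xbar \<in> Fix (alg_op A B l m \<alpha>) \<and> (\<exists>p \<in> A \<inter> B. proj A xbar = {p})"
    using y(2) by (auto simp: Fix_def)
qed

text \<open>Split \<open>x\<close> as \<open>p + (x - p)\<close> with the common point
  \<open>p\<close> of \<open>fixed_point_convex\<close>. Since \<open>x - p\<close> is normal to
  \<open>A\<close> and its negative to \<open>B\<close>, it has nonpositive inner product with every
  \<open>a - b\<close>, so 0 is a nearest point to \<open>x - p\<close> in the difference set and
  \<open>x - p\<close> is even a proximal normal there.\<close>

lemma Fix_convex_subset: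
  fixes A B :: "'a::euclidean_space set"
  assumes cv: "convex A" "convex B" and c: "c \<in> A \<inter> B" and adm: "admissible l m \<alpha>"
  shows "Fix (alg_op A B l m \<alpha>) \<subseteq> (A \<inter> B) + limiting_normal_cone (mink_diff A B) 0"
proof
  fix x assume "x \<in> Fix (alg_op A B l m \<alpha>)"
  then have "x \<in> alg_op A B l m \<alpha> x" by (simp add: Fix_def)
  then obtain p where p: "p \<in> A \<inter> B" "p \<in> proj A x" "\<And>b. b \<in> B \<Longrightarrow> (x - p) \<bullet> (b - p) \<ge> 0"
    using fixed_point_convex[OF cv c adm] by metis
  have 0: "0 \<in> mink_diff A B" using p(1) by (force simp: mink_diff_def)
  have "norm (x - p - 0) \<le> norm (x - p - d)" if dm: "d \<in> mink_diff A B" for d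
  proof -
    obtain a b where d: "d = a - b" "a \<in> A" "b \<in> B" using dm unfolding mink_diff_def by blast
    have "(x - p) \<bullet> (a - p) \<le> 0" using proj_convex_inner_le[OF cv(1) p(2) d(2)] .
    then have "(x - p) \<bullet> d \<le> 0" using p(3)[OF d(3)] by (simp add: d(1) inner_diff_right)
    moreover have "(norm (x - p - d))\<^sup>2 = (norm (x - p))\<^sup>2 - 2 * ((x - p) \<bullet> d) + (norm d)\<^sup>2"
      using power2_norm_eq_inner[of "(x - p) - d"]
      by (simp add: power2_norm_eq_inner inner_diff_left inner_diff_right inner_commute)
    ultimately have "(norm (x - p))\<^sup>2 \<le> (norm (x - p - d))\<^sup>2"
      using zero_le_power2[of "norm d"] by linarith
    then show ?thesis using power2_le_imp_le by simp
  qed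
  then have "0 \<in> proj (mink_diff A B) (x - p)" using 0 proj_iff by blast
  then have "x - p - 0 \<in> prox_normal_cone (mink_diff A B) 0" by (rule prox_normal_coneI)
  then have "x - p \<in> limiting_normal_cone (mink_diff A B) 0"
    using 0 limiting_normal_coneI[OF tendsto_const tendsto_const] by auto
  then have "p + (x - p) \<in> (A \<inter> B) + limiting_normal_cone (mink_diff A B) 0"
    using p(1) by (intro set_plus_intro)
  then show "x \<in> (A \<inter> B) + limiting_normal_cone (mink_diff A B) 0" by simp
qed

theorem corollary5p12:
  fixes A B L :: "'a::euclidean_space set"
    and w :: 'a
    and l m \<alpha> :: real
    and T :: "'a \<Rightarrow> 'a set"
  assumes "closed A" and "closed B" and "A \<inter> B \<noteq> {}"
    and L: "L = affine hull (A \<union> B)"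
    and "w \<in> A \<inter> B"
    and "0 < l" and "l \<le> 2" and "0 < m" and "m \<le> 2"
    and "0 < \<alpha>" and "\<alpha> < 1 + beta_hat l m"
    and T: "T = alg_op A B l m \<alpha>"
  shows
    "\<comment> \<open>(i)(a)\<close>
     (superregular A w \<and> superregular B w \<and> affine_hull_regular A B w \<longrightarrow>
        locally_converges T w (\<lambda>xbar.
          xbar \<in> (A \<inter> B) + orthogonal_comp (mink_diff L L) \<and>
          (\<exists>p \<in> A \<inter> B. proj A xbar = {p} \<and> proj B xbar = {p}) \<and>
          (strongly_regular A B w \<longrightarrow> xbar \<in> A \<inter> B)))
   \<and> \<comment> \<open>(i)(b)\<close>
     (min l m < 2 \<and> superregular A w \<and> superregular B w \<and> linearly_regular_around A B w \<longrightarrow>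
        locally_converges T w (\<lambda>xbar. xbar \<in> A \<inter> B))
   \<and> \<comment> \<open>(ii)(a)\<close>
     (convex A \<and> convex B \<and> rel_interior A \<inter> rel_interior B \<noteq> {} \<longrightarrow>
        globally_converges T (\<lambda>xbar.
          xbar \<in> (A \<inter> B) + orthogonal_comp (mink_diff L L) \<and>
          (\<exists>p \<in> A \<inter> B. proj A xbar = {p} \<and> proj B xbar = {p}) \<and>
          (0 \<in> interior (mink_diff B A) \<longrightarrow> xbar \<in> A \<inter> B)))
   \<and> \<comment> \<open>(ii)(b)\<close>
     (polyhedron A \<and> polyhedron B \<longrightarrow>
        globally_converges T (\<lambda>xbar.
          xbar \<in> Fix T \<and> (\<exists>p \<in> A \<inter> B. proj A xbar = {p})) \<and>
        Fix T \<subseteq> (A \<inter> B) + limiting_normal_cone (mink_diff A B) 0)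
   \<and> \<comment> \<open>(ii)(c)\<close>
     (min l m < 2 \<and> convex A \<and> convex B \<and> boundedly_linearly_regular A B \<longrightarrow>
        globally_converges T (\<lambda>xbar. xbar \<in> A \<inter> B))"
proof -
  have adm: "admissible l m \<alpha>" using assms by (simp add: admissible_def)
  note cl = \<open>closed A\<close> \<open>closed B\<close>
  note w = \<open>w \<in> A \<inter> B\<close> and ne = \<open>A \<inter> B \<noteq> {}\<close>
  show ?thesis
    unfolding T
  proof (intro conjI impI; elim conjE)
    assume "superregular A w" "superregular B w" "affine_hull_regular A B w"
    then show "locally_converges (alg_op A B l m \<alpha>) w (\<lambda>xbar.
          xbar \<in> (A \<inter> B) + orthogonal_comp (mink_diff L L) \<and>
          (\<exists>p \<in> A \<inter> B. proj A xbar = {p} \<and> proj B xbar = {p}) \<and>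
          (strongly_regular A B w \<longrightarrow> xbar \<in> A \<inter> B))"
      by (rule locally_converges_affine_hull_regular[OF cl w adm _ _ _ L])
  next
    assume "min l m < 2" "superregular A w" "superregular B w" "linearly_regular_around A B w"
    then show "locally_converges (alg_op A B l m \<alpha>) w (\<lambda>xbar. xbar \<in> A \<inter> B)"
      by (rule locally_converges_linearly_regular[OF cl w adm])
  next
    assume "convex A" "convex B" "rel_interior A \<inter> rel_interior B \<noteq> {}"
    then show "globally_converges (alg_op A B l m \<alpha>) (\<lambda>xbar.
          xbar \<in> (A \<inter> B) + orthogonal_comp (mink_diff L L) \<and>
          (\<exists>p \<in> A \<inter> B. proj A xbar = {p} \<and> proj B xbar = {p}) \<and>
          (0 \<in> interior (mink_diff B A) \<longrightarrow> xbar \<in> A \<inter> B))"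
      using globally_converges_rel_interior cl adm L by blast
  next
    assume "polyhedron A" "polyhedron B"
    then show "globally_converges (alg_op A B l m \<alpha>) (\<lambda>xbar.
          xbar \<in> Fix (alg_op A B l m \<alpha>) \<and> (\<exists>p \<in> A \<inter> B. proj A xbar = {p}))"
      using globally_converges_polyhedron ne adm by blast
  next
    assume "polyhedron A" "polyhedron B"
    then show "Fix (alg_op A B l m \<alpha>) \<subseteq> (A \<inter> B) + limiting_normal_cone (mink_diff A B) 0"
      using Fix_convex_subset polyhedron_imp_convex w adm by blast
  next
    assume "min l m < 2" "convex A" "convex B" "boundedly_linearly_regular A B"
    then show "globally_converges (alg_op A B l m \<alpha>) (\<lambda>xbar. xbar \<in> A \<inter> B)"
      using globally_converges_boundedly_linearly_regular cl ne adm by blast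
  qed
qed

end
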